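(* Let $k$ be a non-zero commutative ring and let $k[\epsilon]=k[\epsilon]/(\epsilon^2)$ with $\epsilon$ of degree $0$. Let $A=k[u]$ or $A=k[u,u^{-1}]$, regarded as a dg $k$-algebra with zero differential and $u$ of degree $2$, and let $A_u[\epsilon]$ be the cdg $k[\epsilon]$-algebra $A\otimes_k k[\epsilon]$ with zero predifferential and curvature $u\epsilon$. Then there is no "derived" category of $A_u[\epsilon]$ that satisfies (A1) and deforms the classical derived category $D(A)$. Moreover, if $k$ is a field, the only "derived" category $D_?(k[\epsilon]_\epsilon[u,u^{-1}])$ of the cdg algebra $k[\epsilon]_{\epsilon}[u,u^{-1}]$ satisfying (A1) and (A2) is $D_?(k[\epsilon]_{\epsilon}[u,u^{-1}])=0$, where $k[\epsilon]_\epsilon[u,u^{-1}]$ denotes the graded algebra $k[\epsilon][u,u^{-1}]$ with $u$ of degree $2$, zero predifferential and curvature $\epsilon u$ (that is, $k[u,u^{-1}]_u[\epsilon]$).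
   Context: A cdg algebra (over a commutative ground ring) is a $\mathbb{Z}$-graded (associative, unital) algebra $B$ with a degree $1$ graded derivation $d$ (the predifferential) and an element $c\in B^2$ (the curvature) with $d(c)=0$ and $d^2(b)=cb-bc$ for all $b$; a dg algebra is a cdg algebra with $c=0$. A (left) cdg $B$-module is a graded left $B$-module $M$ with a degree $1$ map $d_M$ such that $d_M(bm)=d(b)m+(-1)^{|b|}b\,d_M(m)$ and $d_M^2(m)=cm$. These form an abelian category $\mathsf{Mod}(B)$, with morphisms the degree $0$ $B$-linear maps commuting with the predifferentials. The homotopy category $\underline{\mathsf{Mod}}(B)$ has the same objects, with morphisms taken modulo those of the form $dh+hd$ with $h$ a graded $B$-linear map of degree $-1$; it is triangulated with the usual shift and mapping cones. A "derived" category $D_?(B)$ is a triangle quotient $\underline{\mathsf{Mod}}(B)/\mathcal{A}_?$ by a thick subcategory $\mathcal{A}_?$ (a full triangulated subcategory closed under direct summands), whose objects are called acyclic. Conditions: (A1) $\mathcal{A}_?$ contains all totalizations of short exact sequences $0\to M'\xrightarrow{f} M\xrightarrow{g} M''\to 0$ in $\mathsf{Mod}(B)$ (the totalization is the cone of the map $\mathrm{cone}(f)\to M''$ induced by $g$). (A2) $\mathcal{A}_?$ is closed under coproducts. The reduction $\epsilon\mapsto 0$ is a morphism $A_u[\epsilon]\to A$ of graded algebras, compatible with predifferentials and curvatures, and it induces a restriction of scalars functor $\underline{\mathsf{Mod}}(A)\to\underline{\mathsf{Mod}}(A_u[\epsilon])$. One says that $D_?(A_u[\epsilon])$ deforms $D(A)$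 if a dg $A$-module is acyclic in the classical sense (zero cohomology) if and only if its restriction of scalars to $A_u[\epsilon]$ lies in $\mathcal{A}_?$. *)

theory Defs
  imports "HOL-Library.Poly_Mapping" "HOL-Algebra.Coset"
begin

section \<open>Cdg algebras\<close>

record 'b cdg =
  deg :: "int \<Rightarrow> 'b set"
  predif :: "'b \<Rightarrow> 'b"
  curv :: 'b

definition graded_ring :: "(int \<Rightarrow> 'b::ring_1 set) \<Rightarrow> bool" where
  "graded_ring G \<longleftrightarrow>
     (\<forall>n. 0 \<in> G n \<and> (\<forall>x \<in> G n. \<forall>y \<in> G n. x - y \<in> G n)) \<and>
     (\<forall>b. \<exists>!\<beta>. (\<forall>n. \<beta> n \<in> G n) \<and> finite {n. \<beta> n \<noteq> 0} \<and> b = (\<Sum>n | \<beta> n \<noteq> 0. \<beta> n)) \<and>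
     1 \<in> G 0 \<and>
     (\<forall>m n. \<forall>x \<in> G m. \<forall>y \<in> G n. x * y \<in> G (m + n))"

text \<open>The ground ring \<open>'r\<close> acts through the structure map \<open>\<eta>\<close>.\<close>

definition cdg_algebra :: "('r::comm_ring_1 \<Rightarrow> 'b::ring_1) \<Rightarrow> 'b cdg \<Rightarrow> bool" where
  "cdg_algebra \<eta> B \<longleftrightarrow>
     graded_ring (deg B) \<and>
     \<eta> 1 = 1 \<and> (\<forall>r s. \<eta> (r + s) = \<eta> r + \<eta> s) \<and> (\<forall>r s. \<eta> (r * s) = \<eta> r * \<eta> s) \<and>
     (\<forall>r. \<eta> r \<in> deg B 0) \<and> (\<forall>r b. \<eta> r * b = b * \<eta> r) \<and>
     (\<forall>b b'. predif B (b + b') = predif B b + predif B b') \<and>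
     (\<forall>r b. predif B (\<eta> r * b) = \<eta> r * predif B b) \<and>
     (\<forall>n. \<forall>b \<in> deg B n. predif B b \<in> deg B (n + 1)) \<and>
     (\<forall>n. \<forall>b \<in> deg B n. \<forall>b'. predif B (b * b') =
        predif B b * b' + (if even n then b * predif B b' else - (b * predif B b'))) \<and>
     curv B \<in> deg B 2 \<and> predif B (curv B) = 0 \<and>
     (\<forall>b. predif B (predif B b) = curv B * b - b * curv B)"


section \<open>Cdg modules\<close>

text \<open>
  A graded module is the family of its homogeneous components \<open>comp M n\<close>; these are abelian
  groups in the multiplicative notation of \<^theory>\<open>HOL-Algebra.Group\<close>. For \<open>b\<close> of degree \<open>i\<close>,
  \<open>act M i n b\<close> is the action of \<open>b\<close> from \<open>comp M n\<close> to \<open>comp M (i + n)\<close>; the degree \<open>i\<close> is an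
  explicit argument because signs depend on it.
\<close>

record ('b, 'm) cdg_mod =
  comp :: "int \<Rightarrow> 'm monoid"
  act :: "int \<Rightarrow> int \<Rightarrow> 'b \<Rightarrow> 'm \<Rightarrow> 'm"
  mdif :: "int \<Rightarrow> 'm \<Rightarrow> 'm"

abbreviation elts :: "('b, 'm) cdg_mod \<Rightarrow> int \<Rightarrow> 'm set" where
  "elts M n \<equiv> carrier (comp M n)"

text \<open>\<open>ksign G i x\<close> is \<open>(-1)\<^sup>i x\<close>.\<close>

definition ksign :: "'m monoid \<Rightarrow> int \<Rightarrow> 'm \<Rightarrow> 'm" where
  "ksign G i x = (if even i then x else inv\<^bsub>G\<^esub> x)"

definition cdg_module :: "'b::ring_1 cdg \<Rightarrow> ('b, 'm) cdg_mod \<Rightarrow> bool" where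
  "cdg_module B M \<longleftrightarrow>
     (\<forall>n. comm_group (comp M n)) \<and>
     (\<forall>i n. \<forall>b \<in> deg B i. act M i n b \<in> hom (comp M n) (comp M (i + n))) \<and>
     (\<forall>i n. \<forall>b \<in> deg B i. \<forall>b' \<in> deg B i. \<forall>m \<in> elts M n.
        act M i n (b + b') m = act M i n b m \<otimes>\<^bsub>comp M (i + n)\<^esub> act M i n b' m) \<and>
     (\<forall>n. \<forall>m \<in> elts M n. act M 0 n 1 m = m) \<and>
     (\<forall>i j n. \<forall>b \<in> deg B i. \<forall>b' \<in> deg B j. \<forall>m \<in> elts M n.
        act M (i + j) n (b * b') m = act M i (j + n) b (act M j n b' m)) \<and>
     (\<forall>n. mdif M n \<in> hom (comp M n) (comp M (n + 1))) \<and>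
     (\<forall>i n. \<forall>b \<in> deg B i. \<forall>m \<in> elts M n.
        mdif M (i + n) (act M i n b m) =
          act M (i + 1) n (predif B b) m \<otimes>\<^bsub>comp M (i + n + 1)\<^esub>
          ksign (comp M (i + n + 1)) i (act M i (n + 1) b (mdif M n m))) \<and>
     (\<forall>n. \<forall>m \<in> elts M n. mdif M (n + 1) (mdif M n m) = act M 2 n (curv B) m)"

text \<open>
  The type \<open>'m\<close> plays the role of the universe: \<open>CMod B\<close> consists of the modules whose
  homogeneous components are carried by subsets of \<open>'m\<close>. Constructions which leave this type
  (direct sums, cones) are used up to isomorphism in \<open>CMod B\<close>.
\<close>

definition CMod :: "'b::ring_1 cdg \<Rightarrow> ('b, 'm) cdg_mod set" where
  "CMod B = {M. cdg_module B M}"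

definition cdg_hom ::
  "'b::ring_1 cdg \<Rightarrow> ('b, 'm) cdg_mod \<Rightarrow> ('b, 'n) cdg_mod \<Rightarrow> (int \<Rightarrow> 'm \<Rightarrow> 'n) \<Rightarrow> bool" where
  "cdg_hom B M N f \<longleftrightarrow>
     (\<forall>n. f n \<in> hom (comp M n) (comp N n)) \<and>
     (\<forall>i n. \<forall>b \<in> deg B i. \<forall>m \<in> elts M n. f (i + n) (act M i n b m) = act N i n b (f n m)) \<and>
     (\<forall>n. \<forall>m \<in> elts M n. f (n + 1) (mdif M n m) = mdif N n (f n m))"

definition cdg_comp :: "(int \<Rightarrow> 'n \<Rightarrow> 'p) \<Rightarrow> (int \<Rightarrow> 'm \<Rightarrow> 'n) \<Rightarrow> int \<Rightarrow> 'm \<Rightarrow> 'p" where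
  "cdg_comp g f = (\<lambda>n. g n \<circ> f n)"

definition cdg_id :: "int \<Rightarrow> 'm \<Rightarrow> 'm" where
  "cdg_id = (\<lambda>n m. m)"

definition cdg_isomorphic ::
  "'b::ring_1 cdg \<Rightarrow> ('b, 'm) cdg_mod \<Rightarrow> ('b, 'n) cdg_mod \<Rightarrow> bool" where
  "cdg_isomorphic B M N \<longleftrightarrow>
     (\<exists>f. cdg_hom B M N f \<and> (\<forall>n. bij_betw (f n) (elts M n) (elts N n)))"

definition direct_sum :: "('b, 'm) cdg_mod \<Rightarrow> ('b, 'n) cdg_mod \<Rightarrow> ('b, 'm \<times> 'n) cdg_mod" where
  "direct_sum M N =
     \<lparr>comp = (\<lambda>n. comp M n \<times>\<times> comp N n),
      act = (\<lambda>i n b (x, y). (act M i n b x, act N i n b y)),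
      mdif = (\<lambda>n (x, y). (mdif M n x, mdif N n y))\<rparr>"

text \<open>\<open>shift M\<close> is \<open>M[1]\<close>, with predifferential \<open>-d\<close> and \<open>b \<cdot> m = (-1)\<^sup>|\<^sup>b\<^sup>| b m\<close>.\<close>

definition shift :: "('b, 'm) cdg_mod \<Rightarrow> ('b, 'm) cdg_mod" where
  "shift M =
     \<lparr>comp = (\<lambda>n. comp M (n + 1)),
      act = (\<lambda>i n b m. ksign (comp M (i + n + 1)) i (act M i (n + 1) b m)),
      mdif = (\<lambda>n m. inv\<^bsub>comp M (n + 2)\<^esub> (mdif M (n + 1) m))\<rparr>"

text \<open>\<open>cone M N f\<close> is \<open>N \<oplus> M[1]\<close> with predifferential \<open>(y, x) \<mapsto> (d y + f x, - d x)\<close>.\<close>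

definition cone ::
  "('b, 'm) cdg_mod \<Rightarrow> ('b, 'n) cdg_mod \<Rightarrow> (int \<Rightarrow> 'm \<Rightarrow> 'n) \<Rightarrow> ('b, 'n \<times> 'm) cdg_mod" where
  "cone M N f =
     \<lparr>comp = (\<lambda>n. comp N n \<times>\<times> comp (shift M) n),
      act = (\<lambda>i n b (y, x). (act N i n b y, act (shift M) i n b x)),
      mdif = (\<lambda>n (y, x). (mdif N n y \<otimes>\<^bsub>comp N (n + 1)\<^esub> f (n + 1) x, mdif (shift M) n x))\<rparr>"

definition short_exact ::
  "'b::ring_1 cdg \<Rightarrow> ('b, 'm) cdg_mod \<Rightarrow> ('b, 'n) cdg_mod \<Rightarrow> ('b, 'p) cdg_mod \<Rightarrow>
   (int \<Rightarrow> 'm \<Rightarrow> 'n) \<Rightarrow> (int \<Rightarrow> 'n \<Rightarrow> 'p) \<Rightarrow> bool" where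
  "short_exact B M' M M'' f g \<longleftrightarrow>
     cdg_hom B M' M f \<and> cdg_hom B M M'' g \<and>
     (\<forall>n. inj_on (f n) (elts M' n) \<and>
          f n ` elts M' n = kernel (comp M n) (comp M'' n) (g n) \<and>
          g n ` elts M n = elts M'' n)"

definition totalization ::
  "('b, 'm) cdg_mod \<Rightarrow> ('b, 'n) cdg_mod \<Rightarrow> ('b, 'p) cdg_mod \<Rightarrow>
   (int \<Rightarrow> 'm \<Rightarrow> 'n) \<Rightarrow> (int \<Rightarrow> 'n \<Rightarrow> 'p) \<Rightarrow> ('b, 'p \<times> 'n \<times> 'm) cdg_mod" where
  "totalization M' M M'' f g = cone (cone M' M f) M'' (\<lambda>n (y, x). g n y)"


section \<open>The homotopy category\<close>

text \<open>
  A graded \<open>B\<close>-linear map \<open>h\<close> of degree \<open>-1\<close> satisfies \<open>h (b m) = (-1)\<^sup>|\<^sup>b\<^sup>| b h m\<close>. Morphisms of the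
  homotopy category are represented by maps satisfying \<^const>\<open>cdg_hom\<close>, and equality of
  morphisms by \<open>homotopic\<close>.
\<close>

definition homotopic ::
  "'b::ring_1 cdg \<Rightarrow> ('b, 'm) cdg_mod \<Rightarrow> ('b, 'n) cdg_mod \<Rightarrow>
   (int \<Rightarrow> 'm \<Rightarrow> 'n) \<Rightarrow> (int \<Rightarrow> 'm \<Rightarrow> 'n) \<Rightarrow> bool" where
  "homotopic B M N f g \<longleftrightarrow>
     (\<exists>h. (\<forall>n. h n \<in> hom (comp M n) (comp N (n - 1))) \<and>
          (\<forall>i n. \<forall>b \<in> deg B i. \<forall>m \<in> elts M n.
             h (i + n) (act M i n b m) = ksign (comp N (i + n - 1)) i (act N i (n - 1) b (h n m))) \<and>
          (\<forall>n. \<forall>m \<in> elts M n.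
             f n m = g n m \<otimes>\<^bsub>comp N n\<^esub> (mdif N (n - 1) (h n m) \<otimes>\<^bsub>comp N n\<^esub> h (n + 1) (mdif M n m))))"

definition homotopy_equivalent ::
  "'b::ring_1 cdg \<Rightarrow> ('b, 'm) cdg_mod \<Rightarrow> ('b, 'n) cdg_mod \<Rightarrow> bool" where
  "homotopy_equivalent B M N \<longleftrightarrow>
     (\<exists>f g. cdg_hom B M N f \<and> cdg_hom B N M g \<and>
            homotopic B M M (cdg_comp g f) cdg_id \<and> homotopic B N N (cdg_comp f g) cdg_id)"

definition homotopy_coproduct ::
  "'b::ring_1 cdg \<Rightarrow> 'i set \<Rightarrow> ('i \<Rightarrow> ('b, 'm) cdg_mod) \<Rightarrow> ('b, 'm) cdg_mod \<Rightarrow>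
   ('i \<Rightarrow> int \<Rightarrow> 'm \<Rightarrow> 'm) \<Rightarrow> bool" where
  "homotopy_coproduct B I X C \<iota> \<longleftrightarrow>
     C \<in> CMod B \<and> (\<forall>i \<in> I. X i \<in> CMod B \<and> cdg_hom B (X i) C (\<iota> i)) \<and>
     (\<forall>(Y :: ('b, 'm) cdg_mod) \<in> CMod B. \<forall>g. (\<forall>i \<in> I. cdg_hom B (X i) Y (g i)) \<longrightarrow>
        (\<exists>f. cdg_hom B C Y f \<and> (\<forall>i \<in> I. homotopic B (X i) Y (cdg_comp f (\<iota> i)) (g i)) \<and>
             (\<forall>f'. cdg_hom B C Y f' \<and> (\<forall>i \<in> I. homotopic B (X i) Y (cdg_comp f' (\<iota> i)) (g i)) \<longrightarrow>
                   homotopic B C Y f' f)))"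


section \<open>Acyclic objects and derived categories\<close>

text \<open>
  Thick subcategories of the homotopy category. The condition on shifts is closure under both
  \<open>[1]\<close> and \<open>[-1]\<close>.
\<close>

definition thick_subcategory :: "'b::ring_1 cdg \<Rightarrow> ('b, 'm) cdg_mod set \<Rightarrow> bool" where
  "thick_subcategory B \<A> \<longleftrightarrow>
     \<A> \<subseteq> CMod B \<and> \<A> \<noteq> {} \<and>
     (\<forall>M \<in> \<A>. \<forall>(N :: ('b, 'm) cdg_mod) \<in> CMod B. homotopy_equivalent B M N \<longrightarrow> N \<in> \<A>) \<and>
     (\<forall>(M :: ('b, 'm) cdg_mod) \<in> CMod B. M \<in> \<A> \<longleftrightarrow> shift M \<in> \<A>) \<and>
     (\<forall>M \<in> \<A>. \<forall>N \<in> \<A>. \<forall>f. cdg_hom B M N f \<longrightarrow>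
        (\<forall>(C :: ('b, 'm) cdg_mod) \<in> CMod B. cdg_isomorphic B C (cone M N f) \<longrightarrow> C \<in> \<A>)) \<and>
     (\<forall>(M :: ('b, 'm) cdg_mod) \<in> CMod B. \<forall>(N :: ('b, 'm) cdg_mod) \<in> CMod B. \<forall>X \<in> \<A>.
        homotopy_equivalent B X (direct_sum M N) \<longrightarrow> M \<in> \<A>)"

definition cond_A1 :: "'b::ring_1 cdg \<Rightarrow> ('b, 'm) cdg_mod set \<Rightarrow> bool" where
  "cond_A1 B \<A> \<longleftrightarrow>
     (\<forall>(M' :: ('b, 'm) cdg_mod) \<in> CMod B. \<forall>(M :: ('b, 'm) cdg_mod) \<in> CMod B.
      \<forall>(M'' :: ('b, 'm) cdg_mod) \<in> CMod B. \<forall>f g. short_exact B M' M M'' f g \<longrightarrow>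
        (\<forall>(T :: ('b, 'm) cdg_mod) \<in> CMod B. cdg_isomorphic B T (totalization M' M M'' f g) \<longrightarrow>
           T \<in> \<A>))"

text \<open>Coproducts are indexed by sets of the size of the universe \<open>'m\<close>.\<close>

definition cond_A2 :: "'b::ring_1 cdg \<Rightarrow> ('b, 'm) cdg_mod set \<Rightarrow> bool" where
  "cond_A2 B \<A> \<longleftrightarrow>
     (\<forall>(I :: 'm set) X C \<iota>. (\<forall>i \<in> I. X i \<in> \<A>) \<and> homotopy_coproduct B I X C \<iota> \<longrightarrow> C \<in> \<A>)"

text \<open>
  The quotient of the homotopy category by \<open>\<A>\<close>: a morphism from \<open>M\<close> to \<open>N\<close> is a roof
  \<open>M \<leftarrow> X \<rightarrow> N\<close> whose left leg has its cone in \<open>\<A>\<close>; two roofs are equal if a common refinement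
  makes both legs agree in the homotopy category.
\<close>

definition cone_in ::
  "'b::ring_1 cdg \<Rightarrow> ('b, 'm) cdg_mod set \<Rightarrow> ('b, 'm) cdg_mod \<Rightarrow> ('b, 'm) cdg_mod \<Rightarrow>
   (int \<Rightarrow> 'm \<Rightarrow> 'm) \<Rightarrow> bool" where
  "cone_in B \<A> X M s \<longleftrightarrow> cdg_hom B X M s \<and> (\<exists>C \<in> \<A>. cdg_isomorphic B C (cone X M s))"

type_synonym ('b, 'm) roof = "('b, 'm) cdg_mod \<times> (int \<Rightarrow> 'm \<Rightarrow> 'm) \<times> (int \<Rightarrow> 'm \<Rightarrow> 'm)"

definition roofs ::
  "'b::ring_1 cdg \<Rightarrow> ('b, 'm) cdg_mod set \<Rightarrow> ('b, 'm) cdg_mod \<Rightarrow> ('b, 'm) cdg_mod \<Rightarrow>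
   ('b, 'm) roof set" where
  "roofs B \<A> M N = {(X, s, f). X \<in> CMod B \<and> cone_in B \<A> X M s \<and> cdg_hom B X N f}"

definition roof_eq ::
  "'b::ring_1 cdg \<Rightarrow> ('b, 'm) cdg_mod set \<Rightarrow> ('b, 'm) cdg_mod \<Rightarrow> ('b, 'm) cdg_mod \<Rightarrow>
   ('b, 'm) roof \<Rightarrow> ('b, 'm) roof \<Rightarrow> bool" where
  "roof_eq B \<A> M N = (\<lambda>(X, s, f) (Y, t, g).
     \<exists>Z \<in> CMod B. \<exists>a b. cdg_hom B Z X a \<and> cdg_hom B Z Y b \<and>
       homotopic B Z M (cdg_comp s a) (cdg_comp t b) \<and>
       homotopic B Z N (cdg_comp f a) (cdg_comp g b) \<and>
       cone_in B \<A> Z M (cdg_comp s a))"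

text \<open>The quotient is zero: any two parallel morphisms coincide.\<close>

definition quotient_zero :: "'b::ring_1 cdg \<Rightarrow> ('b, 'm) cdg_mod set \<Rightarrow> bool" where
  "quotient_zero B \<A> \<longleftrightarrow>
     (\<forall>M \<in> CMod B. \<forall>N \<in> CMod B. \<forall>r \<in> roofs B \<A> M N. \<forall>r' \<in> roofs B \<A> M N.
        roof_eq B \<A> M N r r')"

definition acyclic_module :: "('b, 'm) cdg_mod \<Rightarrow> bool" where
  "acyclic_module M \<longleftrightarrow>
     (\<forall>n. kernel (comp M n) (comp M (n + 1)) (mdif M n) = mdif M (n - 1) ` elts M (n - 1))"

definition restrict_scalars :: "('b \<Rightarrow> 'a) \<Rightarrow> ('a, 'm) cdg_mod \<Rightarrow> ('b, 'm) cdg_mod" where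
  "restrict_scalars \<rho> M = \<lparr>comp = comp M, act = (\<lambda>i n b. act M i n (\<rho> b)), mdif = mdif M\<rparr>"

definition deforms :: "'a::ring_1 cdg \<Rightarrow> ('b \<Rightarrow> 'a) \<Rightarrow> ('b, 'm) cdg_mod set \<Rightarrow> bool" where
  "deforms A \<rho> \<A> \<longleftrightarrow> (\<forall>M \<in> CMod A. acyclic_module M \<longleftrightarrow> restrict_scalars \<rho> M \<in> \<A>)"


section \<open>The algebras of the statement\<close>

text \<open>
  Dual numbers over a ring: \<open>Dual a a'\<close> is \<open>a + a' \<epsilon>\<close> with \<open>\<epsilon>\<^sup>2 = 0\<close>. For a commutative ring \<open>k\<close>
  and a \<open>k\<close>-algebra \<open>A\<close>, this is the tensor product of \<open>A\<close> and \<open>k[\<epsilon>]\<close> over \<open>k\<close>.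
\<close>

datatype 'a dual = Dual (std_part: 'a) (eps_part: 'a)

instantiation dual :: (comm_ring_1) comm_ring_1
begin

definition zero_dual where "0 = Dual 0 0"
definition one_dual where "1 = Dual 1 0"
definition plus_dual where
  "x + y = Dual (std_part x + std_part y) (eps_part x + eps_part y)"
definition uminus_dual where "- x = Dual (- std_part x) (- eps_part x)"
definition minus_dual where
  "x - y = Dual (std_part x - std_part y) (eps_part x - eps_part y)"
definition times_dual where
  "x * y = Dual (std_part x * std_part y)
                (std_part x * eps_part y + eps_part x * std_part y)"

instance
  by standard
    (simp_all add: zero_dual_def one_dual_def plus_dual_def uminus_dual_def minus_dual_def
      times_dual_def algebra_simps dual.expand)

end

text \<open>
  \<open>'k[u]\<close> is the monoid algebra \<open>nat \<Rightarrow>\<^sub>0 'k\<close> and \<open>'k[u, u\<^sup>-\<^sup>1]\<close> is \<open>int \<Rightarrow>\<^sub>0 'k\<close>, with \<open>u\<close> the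
  monomial of exponent 1, of degree 2.
\<close>

definition monomial_dga :: "('e \<Rightarrow> int) \<Rightarrow> ('e \<Rightarrow>\<^sub>0 'k::comm_ring_1) cdg" where
  "monomial_dga wt = \<lparr>deg = (\<lambda>n. {f. \<forall>e \<in> Poly_Mapping.keys f. wt e = n}), predif = (\<lambda>f. 0), curv = 0\<rparr>"

definition poly_dga :: "(nat \<Rightarrow>\<^sub>0 'k::comm_ring_1) cdg" where
  "poly_dga = monomial_dga (\<lambda>e. 2 * int e)"

definition laurent_dga :: "(int \<Rightarrow>\<^sub>0 'k::comm_ring_1) cdg" where
  "laurent_dga = monomial_dga (\<lambda>e. 2 * e)"

definition u_var :: "'e::{monoid_add, one} \<Rightarrow>\<^sub>0 'k::comm_ring_1" where
  "u_var = Poly_Mapping.single 1 1"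

text \<open>\<open>first_order_deformation A u\<close> is the cdg algebra on \<open>A[\<epsilon>]\<close> with curvature \<open>u \<epsilon>\<close>,
  for \<open>A\<close> of curvature zero.\<close>

definition first_order_deformation :: "'a::comm_ring_1 cdg \<Rightarrow> 'a \<Rightarrow> 'a dual cdg" where
  "first_order_deformation A u =
     \<lparr>deg = (\<lambda>n. {x. std_part x \<in> deg A n \<and> eps_part x \<in> deg A n}),
      predif = (\<lambda>x. Dual (predif A (std_part x)) (predif A (eps_part x))),
      curv = Dual 0 u\<rparr>"

abbreviation poly_curved :: "(nat \<Rightarrow>\<^sub>0 'k::comm_ring_1) dual cdg" where
  "poly_curved \<equiv> first_order_deformation poly_dga u_var"

abbreviation laurent_curved :: "(int \<Rightarrow>\<^sub>0 'k::comm_ring_1) dual cdg" where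
  "laurent_curved \<equiv> first_order_deformation laurent_dga u_var"

text \<open>
  These are indeed cdg algebras over \<open>k\<close> and \<open>k[\<epsilon>]\<close>, and restriction along \<open>\<epsilon> \<mapsto> 0\<close>
  is defined on cdg modules.
\<close>

lemma dual_sum: "(\<Sum>n\<in>S. Dual (f n) (g n)) = Dual (sum f S) (sum g S)"
  by (induction S rule: infinite_finite_induct) (simp_all add: zero_dual_def plus_dual_def)

lemma graded_ringI:
  fixes G :: "int \<Rightarrow> 'b::ring_1 set" and p :: "int \<Rightarrow> 'b \<Rightarrow> 'b"
  assumes "\<And>n. 0 \<in> G n" "\<And>n x y. x \<in> G n \<Longrightarrow> y \<in> G n \<Longrightarrow> x - y \<in> G n"
    and "1 \<in> G 0" "\<And>m n x y. x \<in> G m \<Longrightarrow> y \<in> G n \<Longrightarrow> x * y \<in> G (m + n)"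
    and p_in: "\<And>n x. p n x \<in> G n"
    and p_add: "\<And>n x y. p n (x + y) = p n x + p n y"
    and p_G: "\<And>m n x. x \<in> G m \<Longrightarrow> p n x = (if m = n then x else 0)"
    and p_fin: "\<And>x. finite {n. p n x \<noteq> 0}"
    and p_sum: "\<And>x. x = (\<Sum>n | p n x \<noteq> 0. p n x)"
  shows "graded_ring G"
proof -
  have p0: "p n 0 = 0" for n using p_add[of n 0 0] by simp
  have p_setsum: "p n (sum \<beta> S) = (\<Sum>m\<in>S. p n (\<beta> m))" for n \<beta> and S :: "int set"
    by (induction S rule: infinite_finite_induct) (simp_all add: p0 p_add)
  have "\<exists>!\<beta>. (\<forall>n. \<beta> n \<in> G n) \<and> finite {n. \<beta> n \<noteq> 0} \<and> b = (\<Sum>n | \<beta> n \<noteq> 0. \<beta> n)" for b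
  proof (rule ex1I[of _ "\<lambda>n. p n b"])
    show "(\<forall>n. p n b \<in> G n) \<and> finite {n. p n b \<noteq> 0} \<and> b = (\<Sum>n | p n b \<noteq> 0. p n b)"
      using p_in p_fin p_sum by blast
    fix \<beta> assume \<beta>: "(\<forall>n. \<beta> n \<in> G n) \<and> finite {n. \<beta> n \<noteq> 0} \<and> b = (\<Sum>n | \<beta> n \<noteq> 0. \<beta> n)"
    show "\<beta> = (\<lambda>n. p n b)"
    proof
      fix n
      have "p n b = (\<Sum>m | \<beta> m \<noteq> 0. p n (\<beta> m))" using \<beta> p_setsum by metis
      also have "\<dots> = (\<Sum>m | \<beta> m \<noteq> 0. if m = n then \<beta> m else 0)"
        using \<beta> p_G by (intro sum.cong) auto
      also have "\<dots> = \<beta> n" using \<beta> by (simp add: sum.delta)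
      finally show "\<beta> n = p n b" by simp
    qed
  qed
  then show ?thesis using assms(1-4) unfolding graded_ring_def by blast
qed

lift_definition degree_part :: "('e \<Rightarrow> int) \<Rightarrow> int \<Rightarrow> ('e \<Rightarrow>\<^sub>0 'k::comm_ring_1) \<Rightarrow> ('e \<Rightarrow>\<^sub>0 'k)"
  is "\<lambda>wt n f e. if wt e = n then f e else 0"
  by (erule rev_finite_subset) auto

lemma degree_part_finite: "finite {n. degree_part wt n f \<noteq> 0}"
proof (rule finite_subset)
  show "{n. degree_part wt n f \<noteq> 0} \<subseteq> wt ` Poly_Mapping.keys f"
  proof
    fix n assume "n \<in> {n. degree_part wt n f \<noteq> 0}"
    then obtain e where "Poly_Mapping.lookup (degree_part wt n f) e \<noteq> 0"
      by (metis (mono_tags) lookup_zero mem_Collect_eq poly_mapping_eqI)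
    then show "n \<in> wt ` Poly_Mapping.keys f"
      by (auto simp: degree_part.rep_eq in_keys_iff split: if_splits)
  qed
qed simp

lemma degree_part_sum: "f = (\<Sum>n | degree_part wt n f \<noteq> 0. degree_part wt n f)"
proof (rule poly_mapping_eqI)
  fix e
  have "Poly_Mapping.lookup (\<Sum>n | degree_part wt n f \<noteq> 0. degree_part wt n f) e =
        (\<Sum>n | degree_part wt n f \<noteq> 0. if wt e = n then Poly_Mapping.lookup f e else 0)"
    by (simp add: lookup_sum degree_part.rep_eq)
  also have "\<dots> = (if degree_part wt (wt e) f \<noteq> 0 then Poly_Mapping.lookup f e else 0)"
    by (simp add: sum.delta degree_part_finite)
  also have "\<dots> = Poly_Mapping.lookup f e"
  proof -
    have "Poly_Mapping.lookup (degree_part wt (wt e) f) e = Poly_Mapping.lookup f e" by (simp add: degree_part.rep_eq)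
    then show ?thesis by (metis lookup_zero)
  qed
  finally show "Poly_Mapping.lookup f e = Poly_Mapping.lookup (\<Sum>n | degree_part wt n f \<noteq> 0. degree_part wt n f) e" by simp
qed

lemma degree_part_same:
  assumes "\<forall>e \<in> Poly_Mapping.keys f. wt e = m"
  shows "degree_part wt n f = (if m = n then f else 0)"
  using assms by (auto intro!: poly_mapping_eqI simp: degree_part.rep_eq in_keys_iff)

lemma degree_part_add: "degree_part wt n (f + g) = degree_part wt n f + degree_part wt n g"
  by (rule poly_mapping_eqI) (simp add: degree_part.rep_eq lookup_add)

lemma degree_part_keys: "\<forall>e \<in> Poly_Mapping.keys (degree_part wt n f). wt e = n"
  by (auto simp: degree_part.rep_eq in_keys_iff split: if_splits)

lemma keys_mult_weight:
  assumes "\<And>a b. wt (a + b) = wt a + wt b" "\<forall>e \<in> Poly_Mapping.keys f. wt e = m" "\<forall>e \<in> Poly_Mapping.keys g. wt e = n"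
  shows "\<forall>e \<in> Poly_Mapping.keys (f * g). wt e = m + n"
  using assms keys_mult[of f g] by fastforce

lemma monomial_dga_cdg_algebra:
  fixes wt :: "'e::comm_monoid_add \<Rightarrow> int"
  assumes wt: "\<And>a b. wt (a + b) = wt a + wt b"
  shows "cdg_algebra (Poly_Mapping.single 0) (monomial_dga wt :: ('e \<Rightarrow>\<^sub>0 'k::comm_ring_1) cdg)"
proof -
  have wt0: "wt 0 = 0" using wt[of 0 0] by simp
  have "graded_ring (\<lambda>n. {f :: 'e \<Rightarrow>\<^sub>0 'k. \<forall>e \<in> Poly_Mapping.keys f. wt e = n})"
  proof (rule graded_ringI[where p = "degree_part wt"])
    fix m n and x y :: "'e \<Rightarrow>\<^sub>0 'k"
    show "x \<in> {f. \<forall>e\<in>Poly_Mapping.keys f. wt e = n} \<Longrightarrow> y \<in> {f. \<forall>e\<in>Poly_Mapping.keys f. wt e = n} \<Longrightarrow>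
        x - y \<in> {f. \<forall>e\<in>Poly_Mapping.keys f. wt e = n}"
      using keys_diff[of x y] by blast
    show "x \<in> {f. \<forall>e\<in>Poly_Mapping.keys f. wt e = m} \<Longrightarrow> y \<in> {f. \<forall>e\<in>Poly_Mapping.keys f. wt e = n} \<Longrightarrow>
        x * y \<in> {f. \<forall>e\<in>Poly_Mapping.keys f. wt e = m + n}"
      using keys_mult_weight[of wt x m y n] wt by blast
    show "x \<in> {f. \<forall>e\<in>Poly_Mapping.keys f. wt e = m} \<Longrightarrow> degree_part wt n x = (if m = n then x else 0)"
      using degree_part_same[of x wt m n] by auto
    show "degree_part wt n x \<in> {f. \<forall>e\<in>Poly_Mapping.keys f. wt e = n}"
      using degree_part_keys[of wt n x] by simp
    show "x = (\<Sum>n | degree_part wt n x \<noteq> 0. degree_part wt n x)"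
      by (rule degree_part_sum)
  qed (simp_all add: wt0 degree_part_add degree_part_finite)
  then show ?thesis
    unfolding cdg_algebra_def monomial_dga_def cdg.simps
    by (intro conjI allI ballI)
      (auto simp: wt0 single_add mult_single intro: mult.commute)
qed

lemma first_order_deformation_cdg_algebra:
  fixes A :: "'a::comm_ring_1 cdg" and \<eta> :: "'k::comm_ring_1 \<Rightarrow> 'a"
  assumes A: "cdg_algebra \<eta> A" and u: "u \<in> deg A 2" "predif A u = 0" and "curv A = 0"
  shows "cdg_algebra (\<lambda>r. Dual (\<eta> (std_part r)) (\<eta> (eps_part r))) (first_order_deformation A u)"
proof -
  let ?G = "\<lambda>n. {x. std_part x \<in> deg A n \<and> eps_part x \<in> deg A n}"
  have gr: "graded_ring (deg A)" using A by (simp add: cdg_algebra_def)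
  have diff: "x \<in> deg A n \<Longrightarrow> y \<in> deg A n \<Longrightarrow> x - y \<in> deg A n" for x y n
    using gr by (simp add: graded_ring_def)
  have z: "0 \<in> deg A n" for n using gr by (simp add: graded_ring_def)
  have add: "x \<in> deg A n \<Longrightarrow> y \<in> deg A n \<Longrightarrow> x + y \<in> deg A n" for x y n
    using diff[of x n "0 - y"] diff[of 0 n y] z[of n] by simp
  have mul: "x \<in> deg A m \<Longrightarrow> y \<in> deg A n \<Longrightarrow> x * y \<in> deg A (m + n)" for x y m n
    using gr by (simp add: graded_ring_def)
  have one: "1 \<in> deg A 0" using gr by (simp add: graded_ring_def)
  have dec: "\<exists>!\<beta>. (\<forall>n. \<beta> n \<in> deg A n) \<and> finite {n. \<beta> n \<noteq> 0} \<and> b = (\<Sum>n | \<beta> n \<noteq> 0. \<beta> n)" for b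
    using gr by (simp add: graded_ring_def)
  have decU: "\<gamma> = \<delta>"
    if "\<forall>n. \<gamma> n \<in> deg A n" "finite {n. \<gamma> n \<noteq> 0}" "b = (\<Sum>n | \<gamma> n \<noteq> 0. \<gamma> n)"
      and "\<forall>n. \<delta> n \<in> deg A n" "finite {n. \<delta> n \<noteq> 0}" "b = (\<Sum>n | \<delta> n \<noteq> 0. \<delta> n)" for \<gamma> \<delta> b
    by (rule ex1E[OF dec[of b]]) (use that in metis)
  have "\<exists>!\<beta>. (\<forall>n. \<beta> n \<in> ?G n) \<and> finite {n. \<beta> n \<noteq> 0} \<and> x = (\<Sum>n | \<beta> n \<noteq> 0. \<beta> n)" (is "?D x") for x
  proof -
    obtain \<alpha> where \<alpha>: "\<forall>n. \<alpha> n \<in> deg A n" "finite {n. \<alpha> n \<noteq> 0}" "std_part x = (\<Sum>n | \<alpha> n \<noteq> 0. \<alpha> n)"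
      using dec[of "std_part x"] by blast
    obtain \<alpha>' where \<alpha>': "\<forall>n. \<alpha>' n \<in> deg A n" "finite {n. \<alpha>' n \<noteq> 0}" "eps_part x = (\<Sum>n | \<alpha>' n \<noteq> 0. \<alpha>' n)"
      using dec[of "eps_part x"] by blast
    let ?S = "{n. Dual (\<alpha> n) (\<alpha>' n) \<noteq> 0}"
    have S: "?S = {n. \<alpha> n \<noteq> 0} \<union> {n. \<alpha>' n \<noteq> 0}" by (auto simp: zero_dual_def)
    have fin: "finite ?S" using \<alpha>(2) \<alpha>'(2) S by simp
    have "sum \<alpha> ?S = std_part x" unfolding \<alpha>(3)
      by (rule sum.mono_neutral_right[OF fin]) (use S in auto)
    moreover have "sum \<alpha>' ?S = eps_part x" unfolding \<alpha>'(3)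
      by (rule sum.mono_neutral_right[OF fin]) (use S in auto)
    ultimately have ex: "x = (\<Sum>n | Dual (\<alpha> n) (\<alpha>' n) \<noteq> 0. Dual (\<alpha> n) (\<alpha>' n))"
      by (simp add: dual_sum)
    have uniq: "\<beta> = (\<lambda>n. Dual (\<alpha> n) (\<alpha>' n))"
      if \<beta>: "(\<forall>n. \<beta> n \<in> ?G n) \<and> finite {n. \<beta> n \<noteq> 0} \<and> x = (\<Sum>n | \<beta> n \<noteq> 0. \<beta> n)" for \<beta>
    proof -
      let ?T = "{n. \<beta> n \<noteq> 0}"
      have T: "finite ?T" using \<beta> by blast
      have "x = Dual (\<Sum>n\<in>?T. std_part (\<beta> n)) (\<Sum>n\<in>?T. eps_part (\<beta> n))"
        using \<beta> dual_sum[of "\<lambda>n. std_part (\<beta> n)" "\<lambda>n. eps_part (\<beta> n)" ?T] by simp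
      then have x: "std_part x = (\<Sum>n\<in>?T. std_part (\<beta> n))" "eps_part x = (\<Sum>n\<in>?T. eps_part (\<beta> n))"
        by (metis dual.sel(1), metis dual.sel(2))
      have sub: "{n. std_part (\<beta> n) \<noteq> 0} \<subseteq> ?T" "{n. eps_part (\<beta> n) \<noteq> 0} \<subseteq> ?T"
        by (auto simp: zero_dual_def)
      have "std_part x = (\<Sum>n | std_part (\<beta> n) \<noteq> 0. std_part (\<beta> n))"
        unfolding x by (rule sum.mono_neutral_right[OF T sub(1)]) auto
      from decU[OF _ finite_subset[OF sub(1) T] this \<alpha>] \<beta>
      have 1: "(\<lambda>n. std_part (\<beta> n)) = \<alpha>" by simp
      have "eps_part x = (\<Sum>n | eps_part (\<beta> n) \<noteq> 0. eps_part (\<beta> n))"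
        unfolding x by (rule sum.mono_neutral_right[OF T sub(2)]) auto
      from decU[OF _ finite_subset[OF sub(2) T] this \<alpha>'] \<beta>
      have 2: "(\<lambda>n. eps_part (\<beta> n)) = \<alpha>'" by simp
      show ?thesis
      proof
        fix n show "\<beta> n = Dual (\<alpha> n) (\<alpha>' n)"
          using fun_cong[OF 1, of n] fun_cong[OF 2, of n] by (cases "\<beta> n") simp
      qed
    qed
    show ?thesis
    proof (rule ex1I[of _ "\<lambda>n. Dual (\<alpha> n) (\<alpha>' n)"])
      show "(\<forall>n. Dual (\<alpha> n) (\<alpha>' n) \<in> ?G n) \<and> finite ?S \<and> x = (\<Sum>n | Dual (\<alpha> n) (\<alpha>' n) \<noteq> 0. Dual (\<alpha> n) (\<alpha>' n))"
        using \<alpha>(1) \<alpha>'(1) fin ex by simp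
    qed (rule uniq)
  qed
  then have D: "\<forall>x. ?D x" by blast
  have "graded_ring ?G"
    unfolding graded_ring_def
    by (intro conjI D)
      (simp_all add: z one diff add mul zero_dual_def one_dual_def minus_dual_def times_dual_def)
  have d_add: "predif A (a + b) = predif A a + predif A b" for a b
    using A by (simp add: cdg_algebra_def)
  have d0: "predif A 0 = 0" using d_add[of 0 0] by simp
  have dd: "predif A (predif A a) = 0" for a
    using A \<open>curv A = 0\<close> by (simp add: cdg_algebra_def)
  have \<eta>: "\<eta> 1 = 1" "\<And>r s. \<eta> (r + s) = \<eta> r + \<eta> s" "\<And>r s. \<eta> (r * s) = \<eta> r * \<eta> s"
    "\<And>r. \<eta> r \<in> deg A 0" "\<And>r b. predif A (\<eta> r * b) = \<eta> r * predif A b"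
    using A by (simp_all add: cdg_algebra_def)
  have \<eta>0: "\<eta> 0 = 0" using \<eta>(2)[of 0 0] by simp
  have d_deg: "b \<in> deg A n \<Longrightarrow> predif A b \<in> deg A (n + 1)" for b n
    using A by (simp add: cdg_algebra_def)
  have leib: "b \<in> deg A n \<Longrightarrow> predif A (b * b') =
      predif A b * b' + (if even n then b * predif A b' else - (b * predif A b'))" for b b' n
    using A by (simp add: cdg_algebra_def)
  show ?thesis
    unfolding cdg_algebra_def first_order_deformation_def cdg.simps
  proof (intro conjI allI ballI \<open>graded_ring ?G\<close>)
    fix n and b b' :: "'a dual" assume "b \<in> ?G n"
    then have b: "std_part b \<in> deg A n" "eps_part b \<in> deg A n" by auto
    show "Dual (predif A (std_part (b * b'))) (predif A (eps_part (b * b'))) =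
        Dual (predif A (std_part b)) (predif A (eps_part b)) * b' +
        (if even n then b * Dual (predif A (std_part b')) (predif A (eps_part b'))
         else - (b * Dual (predif A (std_part b')) (predif A (eps_part b'))))"
      by (simp add: times_dual_def plus_dual_def uminus_dual_def d_add leib[OF b(1)] leib[OF b(2)])
  next
    fix r b show "Dual (\<eta> (std_part r)) (\<eta> (eps_part r)) * b = b * Dual (\<eta> (std_part r)) (\<eta> (eps_part r))"
      by (rule mult.commute)
  next
    fix b
    show "Dual (predif A (std_part (Dual (predif A (std_part b)) (predif A (eps_part b)))))
          (predif A (eps_part (Dual (predif A (std_part b)) (predif A (eps_part b))))) =
        Dual 0 u * b - b * Dual 0 u"
      by (subst mult.commute[of b]) (simp add: dd zero_dual_def)
  qed (use u in \<open>simp_all add: z d0 d_add \<eta> \<eta>0 d_deg zero_dual_def one_dual_def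
        plus_dual_def times_dual_def\<close>)
qed

lemma poly_dga_cdg_algebra: "cdg_algebra (Poly_Mapping.single 0) poly_dga"
  unfolding poly_dga_def by (rule monomial_dga_cdg_algebra) simp

lemma laurent_dga_cdg_algebra: "cdg_algebra (Poly_Mapping.single 0) laurent_dga"
  unfolding laurent_dga_def by (rule monomial_dga_cdg_algebra) simp

lemma curved_cdg_algebra:
  shows "cdg_algebra (\<lambda>r. Dual (Poly_Mapping.single 0 (std_part r)) (Poly_Mapping.single 0 (eps_part r)))
           (poly_curved :: (nat \<Rightarrow>\<^sub>0 'k::comm_ring_1) dual cdg)" (is "cdg_algebra ?\<eta> _")
    and "cdg_algebra (\<lambda>r. Dual (Poly_Mapping.single 0 (std_part r)) (Poly_Mapping.single 0 (eps_part r)))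
           (laurent_curved :: (int \<Rightarrow>\<^sub>0 'k) dual cdg)" (is "cdg_algebra ?\<eta>' _")
proof -
  have "(u_var :: nat \<Rightarrow>\<^sub>0 'k) \<in> deg poly_dga 2" "(u_var :: int \<Rightarrow>\<^sub>0 'k) \<in> deg laurent_dga 2"
    by (simp_all add: poly_dga_def laurent_dga_def monomial_dga_def u_var_def)
  then show "cdg_algebra ?\<eta> (poly_curved :: (nat \<Rightarrow>\<^sub>0 'k) dual cdg)"
    and "cdg_algebra ?\<eta>' (laurent_curved :: (int \<Rightarrow>\<^sub>0 'k) dual cdg)"
    using first_order_deformation_cdg_algebra[OF poly_dga_cdg_algebra]
      first_order_deformation_cdg_algebra[OF laurent_dga_cdg_algebra]
    by (simp_all add: poly_dga_def laurent_dga_def monomial_dga_def)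
qed

lemma restrict_scalars_CMod:
  assumes "curv A = 0" "predif A 0 = 0" "M \<in> CMod A"
  shows "restrict_scalars std_part M \<in> CMod (first_order_deformation A u)"
  using assms
  by (simp add: CMod_def cdg_module_def restrict_scalars_def first_order_deformation_def
      plus_dual_def times_dual_def one_dual_def)

end

theory Submission
  imports Defs
begin

text \<open>
  Let \<open>B = A[\<epsilon>]\<close> with curvature \<open>u \<epsilon>\<close>, and let \<open>\<A>\<close> be a thick subcategory satisfying (A1). All
  three claims come from one phenomenon: \<open>\<A>\<close> contains every module \<open>N\<close> killed by \<open>\<epsilon>\<close> on which
  \<open>u\<close> acts bijectively (\<open>special_fibre_mem\<close>).

  To see this, form the graded module \<open>E = N[1] \<oplus> N \<oplus> N[1]\<close> with coordinates \<open>(z, y, x)\<close>,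
  on which \<open>\<epsilon> (z, y, x) = (x, 0, 0)\<close> and \<open>d (z, y, x) = (u y - d z, d y + x, - d x)\<close>. The
  square of this predifferential is \<open>u \<epsilon>\<close>. The first coordinate spans a submodule \<open>S = N[1]\<close> and
  the quotient by it is the cone \<open>P\<close> of the identity of \<open>N\<close>, but \<open>0 \<rightarrow> S \<rightarrow> E \<rightarrow> P \<rightarrow> 0\<close> does not
  split over \<open>B\<close>, because \<open>\<epsilon>\<close> maps \<open>x\<close> to \<open>z\<close>. Nevertheless the inclusion of \<open>S\<close> is
  null-homotopic when \<open>u\<close> is invertible: \<open>d (0, y, 0) = (u y, d y, 0)\<close>, so \<open>z \<mapsto> (0, u\<^sup>-\<^sup>1 z, 0)\<close> is
  a homotopy, and it is \<open>B\<close>-linear since \<open>\<epsilon>\<close> kills both sides. Hence the totalization of the sequence,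
  which lies in \<open>\<A>\<close> by (A1), contains a shift of \<open>N\<close> as a direct summand, and \<open>N \<in> \<A>\<close>.

  For the first two claims it suffices to exhibit such an \<open>N\<close> that comes from a dg \<open>A\<close>-module which
  is not acyclic. A sum of \<open>k[u, u\<^sup>-\<^sup>1]\<close> and its shift, with zero differential, works over both
  algebras (\<open>not_deforms\<close>).

  For the last claim \<open>u\<close> is a unit of \<open>A\<close>. Every \<open>B\<close>-module \<open>M\<close> is then an extension of
  \<open>\<epsilon> M\<close> by the kernel of \<open>\<epsilon>\<close>, two modules to which the above applies. Since \<open>\<A>\<close> is closed under
  extensions by (A1) (\<open>mem_extension\<close>), it contains all modules, and the quotient is zero. Conversely
  the set of all modules is a thick subcategory with (A1) and (A2).

  Closure properties of \<open>\<A>\<close> are derived throughout from strict retracts: if \<open>M \<rightarrow> X \<rightarrow> M\<close>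
  composes to the identity in the category of modules and \<open>X \<in> \<A>\<close>, then \<open>M\<close> is a direct summand
  of \<open>X\<close>, with complement the kernel of the second map, and so \<open>M \<in> \<A>\<close>
  (\<open>mem_retract\<close>, \<open>represented_retract\<close>).
\<close>

section \<open>Abelian groups and Koszul signs\<close>

text \<open>
  The simplifier turns \<open>n + 1 + 1\<close> into \<open>2 + n\<close>. Degrees are brought to a normal form by
  associating to the left, and these two rules move the numeral to the front of such a sum, so that
  equal degrees become syntactically equal.
\<close>

lemma index_2 [simp]: "i + 2 + n = 2 + i + n" and index_3 [simp]: "i + 3 + n = 3 + i + n" for i n :: int
  by simp_all

lemma DirProd_comm_group:
  assumes "comm_group G" "comm_group H"
  shows "comm_group (G \<times>\<times> H)"
proof -
  interpret G: comm_group G by fact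
  interpret H: comm_group H by fact
  show ?thesis
    by (rule group.group_comm_groupI[OF DirProd_group])
      (auto simp: DirProd_def G.m_comm H.m_comm G.is_group H.is_group)
qed

text \<open>
  \<^const>\<open>ksign\<close> takes a \<^typ>\<open>'m monoid\<close>, whereas \<^locale>\<open>comm_group\<close> is polymorphic in record
  extensions; this locale fixes the type.
\<close>

locale sign_group = comm_group G for G :: "'m monoid" (structure)

lemma (in sign_group) ksign_closed [simp]: "x \<in> carrier G \<Longrightarrow> ksign G i x \<in> carrier G"
  by (simp add: ksign_def)

lemma (in sign_group) ksign_mult:
  "x \<in> carrier G \<Longrightarrow> y \<in> carrier G \<Longrightarrow> ksign G i (x \<otimes> y) = ksign G i x \<otimes> ksign G i y"
  by (simp add: ksign_def inv_mult)

lemma (in sign_group) ksign_one [simp]: "ksign G i \<one> = \<one>"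
  by (simp add: ksign_def)

lemma (in sign_group) ksign_ksign [simp]:
  "x \<in> carrier G \<Longrightarrow> ksign G i (ksign G j x) = ksign G (i + j) x"
  by (auto simp: ksign_def)

lemma (in sign_group) ksign_inv: "x \<in> carrier G \<Longrightarrow> ksign G i (inv x) = inv (ksign G i x)"
  by (simp add: ksign_def)

lemma (in sign_group) cancel [simp]:
  assumes "x \<in> carrier G" "y \<in> carrier G" "z \<in> carrier G"
  shows "x \<otimes> (inv x \<otimes> z) = z" "inv x \<otimes> (x \<otimes> z) = z"
    "x \<otimes> (y \<otimes> (inv x \<otimes> z)) = y \<otimes> z" "inv x \<otimes> (y \<otimes> (x \<otimes> z)) = y \<otimes> z"
    "x \<otimes> (y \<otimes> inv x) = y" "inv x \<otimes> (y \<otimes> x) = y"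
proof -
  have *: "u \<otimes> (v \<otimes> w) = v" if "u \<in> carrier G" "v \<in> carrier G" "w \<in> carrier G" "u \<otimes> w = \<one>" for u v w
    using that m_lcomm[of u v w] by simp
  show 1: "x \<otimes> (inv x \<otimes> z) = z" "inv x \<otimes> (x \<otimes> z) = z"
    using assms by (simp_all add: m_assoc[symmetric])
  show "x \<otimes> (y \<otimes> (inv x \<otimes> z)) = y \<otimes> z" "inv x \<otimes> (y \<otimes> (x \<otimes> z)) = y \<otimes> z"
    using assms m_lcomm[of y "inv x" z] m_lcomm[of y x z] by simp_all (simp_all add: m_assoc[symmetric])
  show "x \<otimes> (y \<otimes> inv x) = y" "inv x \<otimes> (y \<otimes> x) = y"
    using assms by (simp_all add: *)
qed

lemma ksign_0 [simp]: "ksign G 0 x = x" by (simp add: ksign_def)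

lemma ksign_even [simp]: "even i \<Longrightarrow> ksign G i x = x" by (simp add: ksign_def)

lemma (in sign_group) ksign_add_1: "x \<in> carrier G \<Longrightarrow> ksign G (i + 1) x = inv (ksign G i x)"
  by (simp add: ksign_def)

lemma hom_maps_one:
  assumes "h \<in> hom G H" "comm_group G" "comm_group H"
  shows "h \<one>\<^bsub>G\<^esub> = \<one>\<^bsub>H\<^esub>"
  using assms by (auto intro!: hom_one comm_group.axioms(2))

lemma hom_maps_inv:
  assumes "h \<in> hom G H" "comm_group G" "comm_group H" "x \<in> carrier G"
  shows "h (inv\<^bsub>G\<^esub> x) = inv\<^bsub>H\<^esub> (h x)"
  using assms by (auto intro!: group_hom.hom_inv simp: group_hom_def group_hom_axioms_def comm_group.axioms(2))

lemma hom_ksign: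
  assumes "h \<in> hom G H" "comm_group G" "comm_group H" "x \<in> carrier G"
  shows "h (ksign G i x) = ksign H i (h x)"
  using hom_maps_inv[OF assms] by (simp add: ksign_def)

lemma ksign_DirProd [simp]:
  assumes "comm_group G" "comm_group H" "x \<in> carrier G" "y \<in> carrier H"
  shows "ksign (G \<times>\<times> H) i (x, y) = (ksign G i x, ksign H i y)"
  using assms by (simp add: ksign_def comm_group.axioms(2))

section \<open>Curved modules and their morphisms\<close>

locale curved_algebra =
  fixes \<eta> :: "'r::comm_ring_1 \<Rightarrow> 'b::ring_1" and B :: "'b cdg"
  assumes cdg_algebra: "cdg_algebra \<eta> B"
begin

lemma deg_zero [simp]: "0 \<in> deg B n" and deg_one [simp]: "1 \<in> deg B 0"
  and deg_mult [simp]: "\<lbrakk>b \<in> deg B i; b' \<in> deg B j; k = i + j\<rbrakk> \<Longrightarrow> b * b' \<in> deg B k"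
  and deg_diff: "\<lbrakk>b \<in> deg B i; b'' \<in> deg B i\<rbrakk> \<Longrightarrow> b - b'' \<in> deg B i"
  and predif_deg [simp]: "b \<in> deg B i \<Longrightarrow> l = i + 1 \<Longrightarrow> predif B b \<in> deg B l"
  and curv_deg [simp]: "curv B \<in> deg B 2"
  using cdg_algebra by (auto simp: cdg_algebra_def graded_ring_def)

lemma deg_add [simp]: "\<lbrakk>b \<in> deg B i; b' \<in> deg B i\<rbrakk> \<Longrightarrow> b + b' \<in> deg B i"
  using deg_diff[of b i "0 - b'"] deg_diff[of 0 i b'] by simp

lemma predif_add [simp]: "predif B (b + b') = predif B b + predif B b'"
  using cdg_algebra by (simp add: cdg_algebra_def)

end

locale curved_module = curved_algebra \<eta> B for \<eta> :: "'r::comm_ring_1 \<Rightarrow> 'b::ring_1" and B +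
  fixes M :: "('b, 'm) cdg_mod"
  assumes cdg_module: "cdg_module B M"
begin

sublocale comp: sign_group "comp M n" for n
  using cdg_module by (simp add: cdg_module_def sign_group_def)

lemma act_hom: "b \<in> deg B i \<Longrightarrow> act M i n b \<in> hom (comp M n) (comp M (i + n))"
  and act_add: "\<lbrakk>b \<in> deg B i; b' \<in> deg B i; m \<in> elts M n\<rbrakk> \<Longrightarrow>
     act M i n (b + b') m = act M i n b m \<otimes>\<^bsub>comp M (i + n)\<^esub> act M i n b' m"
  and act_unit [simp]: "m \<in> elts M n \<Longrightarrow> act M 0 n 1 m = m"
  and act_act: "\<lbrakk>b \<in> deg B i; b' \<in> deg B j; m \<in> elts M n; k = j + n\<rbrakk> \<Longrightarrow>
     act M i k b (act M j n b' m) = act M (i + j) n (b * b') m"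
  and mdif_hom: "mdif M n \<in> hom (comp M n) (comp M (n + 1))"
  and leibniz: "\<lbrakk>b \<in> deg B i; m \<in> elts M n; k = i + n\<rbrakk> \<Longrightarrow> mdif M k (act M i n b m) =
     act M (i + 1) n (predif B b) m \<otimes>\<^bsub>comp M (i + n + 1)\<^esub>
     ksign (comp M (i + n + 1)) i (act M i (n + 1) b (mdif M n m))"
  and mdif_mdif: "\<lbrakk>m \<in> elts M n; k = n + 1\<rbrakk> \<Longrightarrow> mdif M k (mdif M n m) = act M 2 n (curv B) m"
  using cdg_module unfolding cdg_module_def by (metis | blast)+

text \<open>
  Here and below a degree often enters as a variable \<open>k\<close> with an equation as a premise. The rule then
  applies however the degree is written, and linear arithmetic checks the equation.
\<close>

lemma act_closed [simp]: "\<lbrakk>b \<in> deg B i; m \<in> elts M n; k = i + n\<rbrakk> \<Longrightarrow> act M i n b m \<in> elts M k"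
  using act_hom by (auto simp: hom_def)

lemma mdif_closed [simp]: "\<lbrakk>m \<in> elts M n; k = n + 1\<rbrakk> \<Longrightarrow> mdif M n m \<in> elts M k"
  using mdif_hom by (auto simp: hom_def)

lemma act_mult: "\<lbrakk>b \<in> deg B i; m \<in> elts M n; m' \<in> elts M n\<rbrakk> \<Longrightarrow>
    act M i n b (m \<otimes>\<^bsub>comp M n\<^esub> m') = act M i n b m \<otimes>\<^bsub>comp M (i + n)\<^esub> act M i n b m'"
  using act_hom by (auto simp: hom_def)

lemma act_one [simp]: "b \<in> deg B i \<Longrightarrow> act M i n b \<one>\<^bsub>comp M n\<^esub> = \<one>\<^bsub>comp M (i + n)\<^esub>"
  using hom_maps_one[OF act_hom comp.comm_group_axioms comp.comm_group_axioms] .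

lemma act_inv: "\<lbrakk>b \<in> deg B i; m \<in> elts M n\<rbrakk> \<Longrightarrow>
    act M i n b (inv\<^bsub>comp M n\<^esub> m) = inv\<^bsub>comp M (i + n)\<^esub> (act M i n b m)"
  using hom_maps_inv[OF act_hom comp.comm_group_axioms comp.comm_group_axioms] .

lemma act_ksign: "\<lbrakk>b \<in> deg B i; m \<in> elts M n\<rbrakk> \<Longrightarrow>
    act M i n b (ksign (comp M n) j m) = ksign (comp M (i + n)) j (act M i n b m)"
  using hom_ksign[OF act_hom comp.comm_group_axioms comp.comm_group_axioms] .

lemma mdif_mult: "\<lbrakk>m \<in> elts M n; m' \<in> elts M n\<rbrakk> \<Longrightarrow>
    mdif M n (m \<otimes>\<^bsub>comp M n\<^esub> m') = mdif M n m \<otimes>\<^bsub>comp M (n + 1)\<^esub> mdif M n m'"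
  using mdif_hom by (auto simp: hom_def)

lemma mdif_one [simp]: "mdif M n \<one>\<^bsub>comp M n\<^esub> = \<one>\<^bsub>comp M (n + 1)\<^esub>"
  using hom_maps_one[OF mdif_hom comp.comm_group_axioms comp.comm_group_axioms] .

lemma mdif_inv: "m \<in> elts M n \<Longrightarrow> mdif M n (inv\<^bsub>comp M n\<^esub> m) = inv\<^bsub>comp M (n + 1)\<^esub> (mdif M n m)"
  using hom_maps_inv[OF mdif_hom comp.comm_group_axioms comp.comm_group_axioms] .

lemma mdif_ksign: "m \<in> elts M n \<Longrightarrow>
    mdif M n (ksign (comp M n) j m) = ksign (comp M (n + 1)) j (mdif M n m)"
  using hom_ksign[OF mdif_hom comp.comm_group_axioms comp.comm_group_axioms] .

lemma act_zero [simp]: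
  assumes "m \<in> elts M n"
  shows "act M i n 0 m = \<one>\<^bsub>comp M (i + n)\<^esub>"
  using act_add[of 0 i 0 m n] assms comp.l_cancel_one[of "act M i n 0 m" "i + n" "act M i n 0 m"] by simp

end

lemma cdg_moduleI:
  assumes "\<And>n. comm_group (comp M n)"
    and "\<And>i n b m. b \<in> deg B i \<Longrightarrow> m \<in> elts M n \<Longrightarrow> act M i n b m \<in> elts M (i + n)"
    and "\<And>i n b m m'. b \<in> deg B i \<Longrightarrow> m \<in> elts M n \<Longrightarrow> m' \<in> elts M n \<Longrightarrow>
      act M i n b (m \<otimes>\<^bsub>comp M n\<^esub> m') = act M i n b m \<otimes>\<^bsub>comp M (i + n)\<^esub> act M i n b m'"
    and "\<And>i n b b' m. b \<in> deg B i \<Longrightarrow> b' \<in> deg B i \<Longrightarrow> m \<in> elts M n \<Longrightarrow>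
      act M i n (b + b') m = act M i n b m \<otimes>\<^bsub>comp M (i + n)\<^esub> act M i n b' m"
    and "\<And>n m. m \<in> elts M n \<Longrightarrow> act M 0 n 1 m = m"
    and "\<And>i j n b b' m. b \<in> deg B i \<Longrightarrow> b' \<in> deg B j \<Longrightarrow> m \<in> elts M n \<Longrightarrow>
      act M (i + j) n (b * b') m = act M i (j + n) b (act M j n b' m)"
    and "\<And>n m. m \<in> elts M n \<Longrightarrow> mdif M n m \<in> elts M (n + 1)"
    and "\<And>n m m'. m \<in> elts M n \<Longrightarrow> m' \<in> elts M n \<Longrightarrow>
      mdif M n (m \<otimes>\<^bsub>comp M n\<^esub> m') = mdif M n m \<otimes>\<^bsub>comp M (n + 1)\<^esub> mdif M n m'"
    and "\<And>i n b m. b \<in> deg B i \<Longrightarrow> m \<in> elts M n \<Longrightarrow> mdif M (i + n) (act M i n b m) =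
      act M (i + 1) n (predif B b) m \<otimes>\<^bsub>comp M (i + n + 1)\<^esub>
      ksign (comp M (i + n + 1)) i (act M i (n + 1) b (mdif M n m))"
    and "\<And>n m. m \<in> elts M n \<Longrightarrow> mdif M (n + 1) (mdif M n m) = act M 2 n (curv B) m"
  shows "cdg_module B M"
  unfolding cdg_module_def hom_def using assms by (auto simp: Pi_def)

lemma shift_sel [simp]:
  "comp (shift M) n = comp M (n + 1)"
  "act (shift M) i n b m = ksign (comp M (i + n + 1)) i (act M i (n + 1) b m)"
  "mdif (shift M) n m = inv\<^bsub>comp M (2 + n)\<^esub> (mdif M (n + 1) m)"
  by (simp_all add: shift_def add.commute[of 2])

context curved_module
begin

lemma shift_module: "cdg_module B (shift M)"
proof (rule cdg_moduleI; (unfold shift_sel)?)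
  fix i n b m assume "b \<in> deg B i" "m \<in> elts M (n + 1)"
  then show "inv\<^bsub>comp M (2 + (i + n))\<^esub> mdif M (i + n + 1) (ksign (comp M (i + n + 1)) i (act M i (n + 1) b m)) =
       ksign (comp M (i + 1 + n + 1)) (i + 1) (act M (i + 1) (n + 1) (predif B b) m) \<otimes>\<^bsub>comp M (i + n + 1 + 1)\<^esub>
       ksign (comp M (i + n + 1 + 1)) i (ksign (comp M (i + (n + 1) + 1)) i
         (act M i (n + 1 + 1) b (inv\<^bsub>comp M (2 + n)\<^esub> mdif M (n + 1) m)))"
    by (simp add: leibniz act_mult act_inv mdif_ksign comp.ksign_mult comp.ksign_inv comp.ksign_add_1
        comp.inv_mult add.commute[of i 2] add.assoc[symmetric] del: comp.ksign_ksign)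
qed (simp_all add: comp.comm_group_axioms act_mult act_add act_act act_ksign mdif_mult mdif_inv mdif_mdif
    act_inv comp.ksign_mult comp.inv_mult add.assoc[symmetric])

end

lemma cone_sel [simp]:
  "comp (cone M N f) n = comp N n \<times>\<times> comp (shift M) n"
  "act (cone M N f) i n b (y, x) = (act N i n b y, act (shift M) i n b x)"
  "mdif (cone M N f) n (y, x) = (mdif N n y \<otimes>\<^bsub>comp N (n + 1)\<^esub> f (n + 1) x, mdif (shift M) n x)"
  by (simp_all add: cone_def)

locale module_map = M: curved_module \<eta> B M + N: curved_module \<eta> B N
  for \<eta> :: "'r::comm_ring_1 \<Rightarrow> 'b::ring_1" and B and M :: "('b, 'm) cdg_mod" and N :: "('b, 'n) cdg_mod" +
  fixes f :: "int \<Rightarrow> 'm \<Rightarrow> 'n"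
  assumes cdg_hom: "cdg_hom B M N f"
begin

lemma hom: "f n \<in> hom (comp M n) (comp N n)"
  and hom_act: "\<lbrakk>b \<in> deg B i; m \<in> elts M n; k = i + n\<rbrakk> \<Longrightarrow> f k (act M i n b m) = act N i n b (f n m)"
  and hom_mdif: "\<lbrakk>m \<in> elts M n; k = n + 1\<rbrakk> \<Longrightarrow> f k (mdif M n m) = mdif N n (f n m)"
  using cdg_hom by (auto simp: cdg_hom_def)

lemma hom_closed [simp]: "m \<in> elts M n \<Longrightarrow> f n m \<in> elts N n"
  using hom by (auto simp: hom_def)

lemma hom_mult: "\<lbrakk>m \<in> elts M n; m' \<in> elts M n\<rbrakk> \<Longrightarrow>
    f n (m \<otimes>\<^bsub>comp M n\<^esub> m') = f n m \<otimes>\<^bsub>comp N n\<^esub> f n m'"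
  using hom by (auto simp: hom_def)

lemma hom_one [simp]: "f n \<one>\<^bsub>comp M n\<^esub> = \<one>\<^bsub>comp N n\<^esub>"
  using hom_maps_one[OF hom M.comp.comm_group_axioms N.comp.comm_group_axioms] .

lemma hom_inv: "m \<in> elts M n \<Longrightarrow> f n (inv\<^bsub>comp M n\<^esub> m) = inv\<^bsub>comp N n\<^esub> (f n m)"
  using hom_maps_inv[OF hom M.comp.comm_group_axioms N.comp.comm_group_axioms] .

lemma hom_ksign: "m \<in> elts M n \<Longrightarrow> f n (ksign (comp M n) j m) = ksign (comp N n) j (f n m)"
  using hom_ksign[OF hom M.comp.comm_group_axioms N.comp.comm_group_axioms] .

lemma cone_module: "cdg_module B (cone M N f)"
proof -
  interpret S: curved_module \<eta> B "shift M"
    by unfold_locales (rule M.shift_module)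
  note [simp del] = shift_sel
  have ff: "x \<in> elts (shift M) n \<Longrightarrow> k = n + 1 \<Longrightarrow> f k x \<in> elts N k"
      "x \<in> elts (shift M) n \<Longrightarrow> x' \<in> elts (shift M) n \<Longrightarrow> k = n + 1 \<Longrightarrow>
        f k (x \<otimes>\<^bsub>comp (shift M) n\<^esub> x') = f k x \<otimes>\<^bsub>comp N k\<^esub> f k x'"
      "x \<in> elts (shift M) n \<Longrightarrow> b \<in> deg B i \<Longrightarrow> k = i + n + 1 \<Longrightarrow> l = n + 1 \<Longrightarrow>
        f k (act (shift M) i n b x) = ksign (comp N k) i (act N i l b (f l x))"
      "x \<in> elts (shift M) n \<Longrightarrow> k = n + 2 \<Longrightarrow> l = n + 1 \<Longrightarrow>
        f k (mdif (shift M) n x) = inv\<^bsub>comp N k\<^esub> (mdif N l (f l x))" for x x' n k i b l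
    by (simp_all add: shift_sel hom_mult hom_act hom_mdif hom_inv hom_ksign add.commute[of _ 2] add.assoc)
  show ?thesis
  proof (rule cdg_moduleI)
    fix n show "comm_group (comp (cone M N f) n)"
      by (simp add: DirProd_comm_group N.comp.comm_group_axioms S.comp.comm_group_axioms)
  next
    fix i n b m assume "b \<in> deg B i" "m \<in> elts (cone M N f) n"
    then show "mdif (cone M N f) (i + n) (act (cone M N f) i n b m) =
      act (cone M N f) (i + 1) n (predif B b) m \<otimes>\<^bsub>comp (cone M N f) (i + n + 1)\<^esub>
      ksign (comp (cone M N f) (i + n + 1)) i (act (cone M N f) i (n + 1) b (mdif (cone M N f) n m))"
      by (auto simp: ff N.act_mult S.act_mult N.mdif_mult S.mdif_mult N.act_add S.act_add N.act_act S.act_act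
        N.mdif_mdif S.mdif_mdif N.comp.m_ac S.comp.m_ac N.leibniz S.leibniz
        N.comp.ksign_mult add.assoc[symmetric] N.comp.comm_group_axioms S.comp.comm_group_axioms)
  qed (auto simp: ff N.act_mult S.act_mult N.mdif_mult S.mdif_mult N.act_add S.act_add N.act_act S.act_act
       N.mdif_mdif S.mdif_mdif N.comp.m_ac S.comp.m_ac)
qed

end

lemma cdg_homI:
  assumes "\<And>n m. m \<in> elts M n \<Longrightarrow> f n m \<in> elts N n"
    and "\<And>n m m'. m \<in> elts M n \<Longrightarrow> m' \<in> elts M n \<Longrightarrow>
      f n (m \<otimes>\<^bsub>comp M n\<^esub> m') = f n m \<otimes>\<^bsub>comp N n\<^esub> f n m'"
    and "\<And>i n b m. b \<in> deg B i \<Longrightarrow> m \<in> elts M n \<Longrightarrow> f (i + n) (act M i n b m) = act N i n b (f n m)"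
    and "\<And>n m. m \<in> elts M n \<Longrightarrow> f (n + 1) (mdif M n m) = mdif N n (f n m)"
  shows "cdg_hom B M N f"
  unfolding cdg_hom_def hom_def using assms by (auto simp: Pi_def)

lemma curved_moduleI: "curved_algebra \<eta> B \<Longrightarrow> cdg_module B M \<Longrightarrow> curved_module \<eta> B M"
  by (simp add: curved_module_def curved_module_axioms_def)

lemma module_mapI: "curved_algebra \<eta> B \<Longrightarrow> cdg_module B M \<Longrightarrow> cdg_module B N \<Longrightarrow> cdg_hom B M N f \<Longrightarrow> module_map \<eta> B M N f"
  by (simp add: module_map_def module_map_axioms_def curved_moduleI)

lemma cdg_hom_comp:
  assumes "cdg_hom B M N f" "cdg_hom B N P g"
  shows "cdg_hom B M P (cdg_comp g f)"
  using assms unfolding cdg_hom_def cdg_comp_def hom_def by (auto simp: Pi_def)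

lemma cdg_hom_id: "cdg_hom B M M cdg_id"
  by (simp add: cdg_hom_def cdg_id_def hom_def)

context module_map
begin

lemma shift_hom: "cdg_hom B (shift M) (shift N) (\<lambda>n. f (n + 1))"
  by (rule cdg_homI) (simp_all add: hom_mult hom_act hom_mdif hom_ksign hom_inv add.assoc[symmetric])

lemma cone_inclusion: "cdg_hom B N (cone M N f) (\<lambda>n y. (y, \<one>\<^bsub>comp M (n + 1)\<^esub>))"
  by (rule cdg_homI) (simp_all add: add.assoc[symmetric])

lemma cone_projection: "cdg_hom B (cone M N f) (shift M) (\<lambda>n (y, x). x)"
  by (rule cdg_homI) (auto simp: add.assoc[symmetric])

lemma inverse_hom:
  assumes bij: "\<And>n. bij_betw (f n) (elts M n) (elts N n)"
  shows "cdg_hom B N M (\<lambda>n. inv_into (elts M n) (f n))"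
proof -
  have img: "f n ` elts M n = elts N n" for n using bij by (simp add: bij_betw_def)
  have inj: "inj_on (f n) (elts M n)" for n using bij by (simp add: bij_betw_def)
  have inv_f: "x \<in> elts M n \<Longrightarrow> inv_into (elts M n) (f n) (f n x) = x" for x n
    using inj by (rule inv_into_f_f)
  have f_inv: "y \<in> elts N n \<Longrightarrow> f n (inv_into (elts M n) (f n) y) = y" for y n
    using img f_inv_into_f by metis
  have mem: "y \<in> elts N n \<Longrightarrow> inv_into (elts M n) (f n) y \<in> elts M n" for y n
    using img inv_into_into by metis
  have eq: "f n x = y \<Longrightarrow> x \<in> elts M n \<Longrightarrow> inv_into (elts M n) (f n) y = x" for x y n
    using inv_f by metis
  show ?thesis
    by (rule cdg_homI) (auto intro!: eq simp: mem f_inv hom_mult hom_act hom_mdif)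
qed

end

context curved_algebra
begin

lemma cdg_isomorphic_refl: "cdg_isomorphic B M M"
  unfolding cdg_isomorphic_def using cdg_hom_id[of B M] bij_betw_id
  by (intro exI[of _ cdg_id]) (auto simp: cdg_id_def bij_betw_def)

lemma cdg_isomorphic_trans:
  assumes "cdg_isomorphic B M N" "cdg_isomorphic B N P"
  shows "cdg_isomorphic B M P"
proof -
  from assms obtain f g where "cdg_hom B M N f" "cdg_hom B N P g"
    "\<And>n. bij_betw (f n) (elts M n) (elts N n)" "\<And>n. bij_betw (g n) (elts N n) (elts P n)"
    unfolding cdg_isomorphic_def by blast
  then show ?thesis unfolding cdg_isomorphic_def
    by (intro exI[of _ "cdg_comp g f"]) (auto simp: cdg_comp_def intro: bij_betw_trans cdg_hom_comp[unfolded cdg_comp_def])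
qed

lemma cdg_isomorphic_sym:
  assumes "cdg_module B M" "cdg_module B N" "cdg_isomorphic B M N"
  shows "cdg_isomorphic B N M"
proof -
  from assms(3) obtain f where f: "cdg_hom B M N f" "\<And>n. bij_betw (f n) (elts M n) (elts N n)"
    unfolding cdg_isomorphic_def by blast
  interpret module_map \<eta> B M N f by (rule module_mapI[OF curved_algebra_axioms assms(1,2) f(1)])
  show ?thesis unfolding cdg_isomorphic_def
    using inverse_hom[OF f(2)] bij_betw_inv_into[OF f(2)] by blast
qed

lemma homotopicI:
  assumes "cdg_module B M" "cdg_module B N"
    and "\<And>n m. m \<in> elts M n \<Longrightarrow> f n m \<in> elts N n"
    and eq: "\<And>n m. m \<in> elts M n \<Longrightarrow> f n m = g n m"
  shows "homotopic B M N f g"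
proof -
  interpret M: curved_module \<eta> B M using assms(1) by (intro curved_moduleI curved_algebra_axioms)
  interpret N: curved_module \<eta> B N using assms(2) by (intro curved_moduleI curved_algebra_axioms)
  have idx: "i + (n - 1) = i + n - 1" for i n :: int by simp
  have 1: "mdif N (n - 1) \<one>\<^bsub>comp N (n - 1)\<^esub> = \<one>\<^bsub>comp N n\<^esub>" for n
    using N.mdif_one[of "n - 1"] by simp
  show ?thesis unfolding homotopic_def
    by (rule exI[of _ "\<lambda>n m. \<one>\<^bsub>comp N (n - 1)\<^esub>"])
      (use assms(3) in \<open>auto simp: hom_def idx 1 eq[symmetric]\<close>)
qed

end

section \<open>Transport of structure\<close>

text \<open>
  Thick subcategories consist of modules carried by one fixed type, while cones and totalizations are
  carried by products of that type. An injection into the fixed type gives an isomorphic copy there.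
\<close>

definition transport :: "('n \<Rightarrow> 'm) \<Rightarrow> ('b, 'n) cdg_mod \<Rightarrow> ('b, 'm) cdg_mod" where
  "transport j M =
     \<lparr>comp = (\<lambda>n. \<lparr>carrier = j ` elts M n,
                   monoid.mult = (\<lambda>x y. j (inv_into UNIV j x \<otimes>\<^bsub>comp M n\<^esub> inv_into UNIV j y)), one = j \<one>\<^bsub>comp M n\<^esub>\<rparr>),
      act = (\<lambda>i n b x. j (act M i n b (inv_into UNIV j x))),
      mdif = (\<lambda>n x. j (mdif M n (inv_into UNIV j x)))\<rparr>"

lemma transport_sel [simp]:
  assumes "inj j"
  shows "elts (transport j M) n = j ` elts M n"
   "j x \<otimes>\<^bsub>comp (transport j M) n\<^esub> j y = j (x \<otimes>\<^bsub>comp M n\<^esub> y)"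
   "\<one>\<^bsub>comp (transport j M) n\<^esub> = j \<one>\<^bsub>comp M n\<^esub>"
   "act (transport j M) i n b (j x) = j (act M i n b x)"
   "mdif (transport j M) n (j x) = j (mdif M n x)"
  using assms by (simp_all add: transport_def)

lemma (in curved_module) transport_comm_group:
  assumes "inj j"
  shows "comm_group (comp (transport j M) n)"
proof (rule comm_groupI)
  fix x assume "x \<in> elts (transport j M) n"
  then obtain m where m: "m \<in> elts M n" "x = j m" using assms by auto
  show "\<exists>y \<in> elts (transport j M) n. y \<otimes>\<^bsub>comp (transport j M) n\<^esub> x = \<one>\<^bsub>comp (transport j M) n\<^esub>"
    by (rule bexI[of _ "j (inv\<^bsub>comp M n\<^esub> m)"]) (use m assms in simp_all)
qed (use assms in \<open>auto simp: comp.m_ac\<close>)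

lemma (in curved_module) transport_module:
  assumes "inj j"
  shows "cdg_module B (transport j M)"
proof -
  have "j \<in> hom (comp M n) (comp (transport j M) n)" for n
    using assms by (auto simp: hom_def)
  from hom_ksign[OF this comp.comm_group_axioms transport_comm_group[OF assms], symmetric]
  have ks: "m \<in> elts M n \<Longrightarrow> ksign (comp (transport j M) n) i (j m) = j (ksign (comp M n) i m)" for m n i .
  show ?thesis
    by (rule cdg_moduleI)
      (use assms in \<open>auto simp: transport_comm_group act_mult act_add act_act mdif_mult leibniz mdif_mdif ks add.assoc[symmetric]\<close>)
qed

lemma transport_isomorphic:
  assumes "inj j"
  shows "cdg_isomorphic B M (transport j M)"
  unfolding cdg_isomorphic_def
  by (rule exI[of _ "\<lambda>n. j"], intro conjI cdg_homI)
    (use assms in \<open>auto simp: bij_betw_def intro: inj_on_subset\<close>)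

section \<open>Submodules, kernels and images\<close>

definition submodule :: "('b, 'm) cdg_mod \<Rightarrow> (int \<Rightarrow> 'm set) \<Rightarrow> ('b, 'm) cdg_mod" where
  "submodule M S = M\<lparr>comp := \<lambda>n. comp M n\<lparr>carrier := S n\<rparr>\<rparr>"

lemma submodule_sel [simp]:
  "comp (submodule M S) n = comp M n\<lparr>carrier := S n\<rparr>"
  "act (submodule M S) = act M" "mdif (submodule M S) = mdif M"
  by (simp_all add: submodule_def)

lemma (in curved_module) submodule_module:
  assumes S: "\<And>n. subgroup (S n) (comp M n)"
    and a: "\<And>i n b m. b \<in> deg B i \<Longrightarrow> m \<in> S n \<Longrightarrow> act M i n b m \<in> S (i + n)"
    and d: "\<And>n m. m \<in> S n \<Longrightarrow> mdif M n m \<in> S (n + 1)"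
  shows "cdg_module B (submodule M S)"
proof -
  have sub: "m \<in> S n \<Longrightarrow> m \<in> elts M n" for m n
    using S subgroup.mem_carrier by metis
  have ks: "m \<in> S n \<Longrightarrow> ksign (comp M n\<lparr>carrier := S n\<rparr>) i m = ksign (comp M n) i m" for m n i
    using comp.m_inv_consistent[OF S] by (simp add: ksign_def)
  have ms: "b \<in> deg B i \<Longrightarrow> m \<in> S n \<Longrightarrow> act M i (n + 1) b (mdif M n m) \<in> S (i + n + 1)" for i b m n
    using a[OF _ d, of b i m n] by (simp add: add.assoc)
  show ?thesis
  proof (rule cdg_moduleI)
    fix n show "comm_group (comp (submodule M S) n)"
      by (rule group.group_comm_groupI)
        (use subgroup.subgroup_is_group[OF S comp.is_group] comp.m_comm sub in auto)
  qed (use a d ms in \<open>auto simp: sub ks act_mult act_add act_act mdif_mult leibniz mdif_mdif add.assoc[symmetric]\<close>)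
qed

context module_map
begin

lemma group_hom: "group_hom (comp M n) (comp N n) (f n)"
  using hom by (simp add: group_hom_def group_hom_axioms_def M.comp.is_group N.comp.is_group)

lemma kernel_module: "cdg_module B (submodule M (\<lambda>n. kernel (comp M n) (comp N n) (f n)))"
  by (rule M.submodule_module)
    (auto simp: kernel_def hom_act hom_mdif intro: group_hom.subgroup_kernel[OF group_hom, unfolded kernel_def])

lemma image_module: "cdg_module B (submodule N (\<lambda>n. f n ` elts M n))"
proof (rule N.submodule_module)
  fix n show "subgroup (f n ` elts M n) (comp N n)"
    by (rule group_hom.img_is_subgroup[OF group_hom])
qed (auto simp: hom_act[symmetric] hom_mdif[symmetric])

lemma kernel_image_short_exact:
  "short_exact B (submodule M (\<lambda>n. kernel (comp M n) (comp N n) (f n))) M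
     (submodule N (\<lambda>n. f n ` elts M n)) cdg_id f"
  unfolding short_exact_def cdg_hom_def
  using cdg_hom by (auto simp: cdg_id_def hom_def kernel_def cdg_hom_def)

end

section \<open>Isomorphic shifts and cones\<close>

lemma (in curved_algebra) isomorphic_inverses:
  assumes "cdg_module B M" "cdg_module B N" "cdg_isomorphic B M N"
  shows "\<exists>f g. cdg_hom B M N f \<and> cdg_hom B N M g \<and>
    (\<forall>n. \<forall>x \<in> elts M n. g n (f n x) = x) \<and> (\<forall>n. \<forall>y \<in> elts N n. f n (g n y) = y)"
proof -
  from assms(3) obtain f where f: "cdg_hom B M N f" "\<And>n. bij_betw (f n) (elts M n) (elts N n)"
    unfolding cdg_isomorphic_def by blast
  interpret module_map \<eta> B M N f by (rule module_mapI[OF curved_algebra_axioms assms(1,2) f(1)])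
  show ?thesis
    using f(1) inverse_hom[OF f(2)] bij_betw_inv_into_left[OF f(2)] bij_betw_inv_into_right[OF f(2)]
    by (intro exI[of _ f] exI[of _ "\<lambda>n. inv_into (elts M n) (f n)"]) blast
qed

lemma cdg_hom_mem: "cdg_hom B M N f \<Longrightarrow> x \<in> elts M n \<Longrightarrow> f n x \<in> elts N n"
  by (auto simp: cdg_hom_def hom_def)

lemma shift_isomorphic:
  assumes "curved_algebra \<eta> B" "cdg_module B M" "cdg_module B N" "cdg_isomorphic B M N"
  shows "cdg_isomorphic B (shift M) (shift N)"
proof -
  from assms(4) obtain f where f: "cdg_hom B M N f" "\<And>n. bij_betw (f n) (elts M n) (elts N n)"
    unfolding cdg_isomorphic_def by blast
  interpret module_map \<eta> B M N f by (rule module_mapI[OF assms(1-3) f(1)])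
  show ?thesis unfolding cdg_isomorphic_def using shift_hom f(2) by auto
qed

lemma cone_map:
  assumes alg: "curved_algebra \<eta> B" and mods: "cdg_module B M" "cdg_module B M'" "cdg_module B N" "cdg_module B N'"
    and \<phi>: "cdg_hom B M M' \<phi>" "\<And>n. bij_betw (\<phi> n) (elts M n) (elts M' n)"
    and \<psi>: "cdg_hom B N N' \<psi>" "\<And>n. bij_betw (\<psi> n) (elts N n) (elts N' n)"
    and f: "cdg_hom B M N f" and f': "cdg_hom B M' N' f'"
    and comm: "\<And>n m. m \<in> elts M n \<Longrightarrow> \<psi> n (f n m) = f' n (\<phi> n m)"
  shows "cdg_hom B (cone M N f) (cone M' N' f') (\<lambda>n (y, x). (\<psi> n y, \<phi> (n + 1) x))"
    and "bij_betw (\<lambda>(y, x). (\<psi> n y, \<phi> (n + 1) x)) (elts (cone M N f) n) (elts (cone M' N' f') n)"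
proof -
  interpret \<phi>: module_map \<eta> B M M' \<phi> by (rule module_mapI) fact+
  interpret \<psi>: module_map \<eta> B N N' \<psi> by (rule module_mapI) fact+
  interpret f: module_map \<eta> B M N f by (rule module_mapI) fact+
  interpret f': module_map \<eta> B M' N' f' by (rule module_mapI) fact+
  show "cdg_hom B (cone M N f) (cone M' N' f') (\<lambda>n (y, x). (\<psi> n y, \<phi> (n + 1) x))"
    by (rule cdg_homI)
      (auto simp: \<phi>.hom_mult \<psi>.hom_mult \<phi>.hom_act \<psi>.hom_act \<phi>.hom_mdif \<psi>.hom_mdif
        \<phi>.hom_inv \<phi>.hom_ksign comm add.assoc[symmetric])
  have "bij_betw (map_prod (\<psi> n) (\<phi> (n + 1))) (elts N n \<times> elts M (n + 1)) (elts N' n \<times> elts M' (n + 1))"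
    by (intro bij_betw_map_prod \<phi> \<psi>)
  then show "bij_betw (\<lambda>(y, x). (\<psi> n y, \<phi> (n + 1) x)) (elts (cone M N f) n) (elts (cone M' N' f') n)"
    by (simp add: map_prod_def)
qed

section \<open>Thick subcategories up to isomorphism\<close>

lemma infinite_square_embeds:
  assumes "infinite (UNIV :: 'm set)"
  shows "\<exists>j :: 'm \<times> 'm \<Rightarrow> 'm. inj j"
proof -
  obtain j :: "'m \<times> 'm \<Rightarrow> 'm" where "bij_betw j (UNIV \<times> UNIV) UNIV"
    using iffD2[OF card_of_ordIso card_of_Times_same_infinite[OF assms]] by (elim exE)
  then have "inj j" by (simp add: bij_betw_def)
  then show ?thesis by (rule exI[of inj])
qed

locale thick = curved_algebra \<eta> B for \<eta> :: "'r::comm_ring_1 \<Rightarrow> 'b::ring_1" and B +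
  fixes \<A> :: "('b, 'm) cdg_mod set"
  assumes thick: "thick_subcategory B \<A>"
    and infinite_universe: "infinite (UNIV :: 'm set)"
begin

text \<open>
  Membership in \<open>\<A>\<close> for a module over an arbitrary type: an isomorphic copy lies in \<open>\<A>\<close>. This makes
  it possible to work with cones and totalizations as they are.
\<close>

definition represented :: "('b, 'n) cdg_mod \<Rightarrow> bool" where
  "represented M \<longleftrightarrow> cdg_module B M \<and> (\<exists>C \<in> \<A>. cdg_isomorphic B C M)"

lemma embeds_self: "\<exists>j :: 'm \<Rightarrow> 'm. inj j"
  by (rule exI[of inj id]) simp

lemma embeds_prod:
  assumes "\<exists>j :: 'x \<Rightarrow> 'm. inj j" "\<exists>j :: 'y \<Rightarrow> 'm. inj j"
  shows "\<exists>j :: 'x \<times> 'y \<Rightarrow> 'm. inj j"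
proof -
  obtain j1 :: "'x \<Rightarrow> 'm" and j2 :: "'y \<Rightarrow> 'm" and j :: "'m \<times> 'm \<Rightarrow> 'm" where j: "inj j1" "inj j2" "inj j"
    using assms infinite_square_embeds[OF infinite_universe] by (elim exE)
  have "inj (j \<circ> map_prod j1 j2)" by (rule inj_compose[OF j(3) prod.inj_map[OF j(1,2)]])
  then show ?thesis by (rule exI[of inj])
qed

lemma mem_module: "C \<in> \<A> \<Longrightarrow> cdg_module B C"
  using thick[unfolded thick_subcategory_def, THEN conjunct1] by (auto simp: CMod_def)

lemma thick_summand:
  fixes M N X :: "('b, 'm) cdg_mod"
  assumes "M \<in> CMod B" "N \<in> CMod B" "X \<in> \<A>" "homotopy_equivalent B X (direct_sum M N)"
  shows "M \<in> \<A>"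
proof -
  note thick[unfolded thick_subcategory_def, THEN conjunct2, THEN conjunct2, THEN conjunct2, THEN conjunct2, THEN conjunct2]
  from this[THEN bspec, OF assms(1), THEN bspec, OF assms(2), THEN bspec, OF assms(3), THEN mp, OF assms(4)]
  show ?thesis .
qed

text \<open>
  With \<open>K\<close> the kernel of \<open>r\<close>, the maps \<open>c \<mapsto> (r c, c - s (r c))\<close> and \<open>(m, y) \<mapsto> s m + y\<close> are mutually
  inverse isomorphisms between \<open>C\<close> and \<open>M \<oplus> K\<close>, so that closure under direct summands applies.
\<close>

lemma mem_retract:
  assumes C: "C \<in> \<A>" and M: "cdg_module B M" and s: "cdg_hom B M C s" and r: "cdg_hom B C M r"
    and rs: "\<And>n m. m \<in> elts M n \<Longrightarrow> r n (s n m) = m"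
  shows "M \<in> \<A>"
proof -
  interpret s: module_map \<eta> B M C s by (rule module_mapI[OF curved_algebra_axioms M mem_module[OF C] s])
  interpret r: module_map \<eta> B C M r by (rule module_mapI[OF curved_algebra_axioms mem_module[OF C] M r])
  let ?K = "\<lambda>n. kernel (comp C n) (comp M n) (r n)"
  let ?N = "submodule C ?K"
  have K: "x \<in> ?K n \<longleftrightarrow> x \<in> elts C n \<and> r n x = \<one>\<^bsub>comp M n\<^esub>" for x n
    by (auto simp: kernel_def)
  have N: "cdg_module B ?N" by (rule r.kernel_module)
  interpret N: curved_module \<eta> B ?N by (rule curved_moduleI[OF curved_algebra_axioms N])
  have MN: "cdg_module B (direct_sum M ?N)"
    by (rule cdg_moduleI)
     (auto simp: direct_sum_def DirProd_comm_group s.M.comp.comm_group_axioms N.comp.comm_group_axioms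
      s.M.act_mult N.act_mult s.M.act_add N.act_add s.M.act_act N.act_act s.M.mdif_mult N.mdif_mult
      s.M.leibniz N.leibniz s.M.mdif_mdif N.mdif_mdif add.assoc[symmetric] simp del: submodule_sel)
  let ?f = "\<lambda>n c. (r n c, c \<otimes>\<^bsub>comp C n\<^esub> inv\<^bsub>comp C n\<^esub> (s n (r n c)))"
  let ?g = "\<lambda>n (m, y). s n m \<otimes>\<^bsub>comp C n\<^esub> y"
  have f: "cdg_hom B C (direct_sum M ?N) ?f"
    by (rule cdg_homI)
      (auto simp: direct_sum_def K r.hom_mult s.hom_mult r.hom_inv s.hom_inv r.hom_act s.hom_act r.hom_mdif s.hom_mdif
        s.N.act_mult s.N.act_inv s.N.mdif_mult s.N.mdif_inv rs s.N.comp.inv_mult s.N.comp.m_ac)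
  have g: "cdg_hom B (direct_sum M ?N) C ?g"
    by (rule cdg_homI)
      (auto simp: direct_sum_def K s.hom_mult s.hom_act s.hom_mdif
        s.N.act_mult s.N.mdif_mult s.N.comp.m_ac)
  have gf: "?g n (?f n c) = c" if "c \<in> elts C n" for n c
    using that by (simp add: s.N.comp.m_comm[of "s n (r n c)"] s.N.comp.m_assoc)
  have fg: "?f n (?g n x) = x" if "x \<in> elts (direct_sum M ?N) n" for n x
    using that by (auto simp: direct_sum_def K r.hom_mult rs s.N.comp.m_ac)
  have he: "homotopy_equivalent B C (direct_sum M ?N)"
    unfolding homotopy_equivalent_def
  proof (intro exI[of _ ?f] exI[of _ ?g] conjI f g)
    show "homotopic B C C (cdg_comp ?g ?f) cdg_id"
      by (rule homotopicI) (simp_all add: mem_module[OF C] cdg_comp_def cdg_id_def gf[simplified])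
    show "homotopic B (direct_sum M ?N) (direct_sum M ?N) (cdg_comp ?f ?g) cdg_id"
      by (rule homotopicI[OF MN MN]) (use fg in \<open>simp_all add: cdg_comp_def cdg_id_def\<close>)
  qed
  show ?thesis
    by (rule thick_summand[OF _ _ C he]) (simp_all add: CMod_def M N del: submodule_sel)
qed

lemma represented_mem_iff: "represented M \<longleftrightarrow> M \<in> \<A>"
proof
  assume "represented M"
  then obtain C where C: "C \<in> \<A>" "cdg_module B M" "cdg_isomorphic B C M"
    unfolding represented_def by blast
  from isomorphic_inverses[OF mem_module[OF C(1)] C(2,3)]
  obtain f g where fg: "cdg_hom B C M f" "cdg_hom B M C g" "\<forall>n. \<forall>y \<in> elts M n. f n (g n y) = y"
    by blast
  show "M \<in> \<A>" by (rule mem_retract[OF C(1,2) fg(2,1)]) (use fg(3) in simp)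
next
  assume M: "M \<in> \<A>"
  show "represented M"
    unfolding represented_def using mem_module[OF M] M cdg_isomorphic_refl[of M] by (intro conjI bexI[of _ M])
qed

lemma represented_isomorphic:
  assumes "represented M" "cdg_module B N" "cdg_isomorphic B M N"
  shows "represented N"
proof -
  obtain C where "C \<in> \<A>" "cdg_isomorphic B C M"
    using assms(1) unfolding represented_def by blast
  with cdg_isomorphic_trans[OF this(2) assms(3)] assms(2) show ?thesis
    unfolding represented_def by blast
qed

text \<open>
  It is convenient to allow the composite \<open>p s\<close> to be any isomorphism \<open>M \<rightarrow> L\<close>: the retraction is then
  \<open>(p s)\<^sup>-\<^sup>1 p\<close>, and no inverse has to be written down by the user of the lemma.
\<close>

lemma represented_retract:
  fixes M :: "('b, 'n) cdg_mod"
  assumes X: "represented X" and M: "cdg_module B M" and L: "cdg_module B L"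
    and emb: "\<exists>j :: 'n \<Rightarrow> 'm. inj j"
    and s: "cdg_hom B M X s" and p: "cdg_hom B X L p"
    and bij: "\<And>n. bij_betw (\<lambda>m. p n (s n m)) (elts M n) (elts L n)"
  shows "represented M"
proof -
  obtain C where C: "C \<in> \<A>" and iso: "cdg_module B X" "cdg_isomorphic B C X"
    using X unfolding represented_def by blast
  from isomorphic_inverses[OF mem_module[OF C] iso]
  obtain \<phi> \<psi> where \<phi>: "cdg_hom B C X \<phi>" and \<psi>: "cdg_hom B X C \<psi>"
      and \<phi>\<psi>: "\<forall>n. \<forall>y \<in> elts X n. \<phi> n (\<psi> n y) = y"
    by blast
  obtain j :: "'n \<Rightarrow> 'm" where j: "inj j" using emb by blast
  have M0: "cdg_module B (transport j M)"
    using curved_module.transport_module[OF curved_moduleI[OF curved_algebra_axioms M] j] .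
  from isomorphic_inverses[OF M M0 transport_isomorphic[OF j]]
  obtain \<tau> \<tau>' where \<tau>: "cdg_hom B M (transport j M) \<tau>" and \<tau>': "cdg_hom B (transport j M) M \<tau>'"
      and \<tau>\<tau>': "\<forall>n. \<forall>y \<in> elts (transport j M) n. \<tau> n (\<tau>' n y) = y"
    by blast
  have ps: "cdg_hom B M L (cdg_comp p s)" using s p by (rule cdg_hom_comp)
  interpret ps: module_map \<eta> B M L "cdg_comp p s" by (rule module_mapI[OF curved_algebra_axioms M L ps])
  have bij': "bij_betw (cdg_comp p s n) (elts M n) (elts L n)" for n
    using bij by (simp add: cdg_comp_def o_def)
  define q where "q = (\<lambda>n. inv_into (elts M n) (cdg_comp p s n))"
  have q: "cdg_hom B L M q" unfolding q_def by (rule ps.inverse_hom[OF bij'])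
  have qps: "q n (p n (s n m)) = m" if "m \<in> elts M n" for n m
    using bij_betw_inv_into_left[OF bij' that] by (simp add: q_def cdg_comp_def)
  have "transport j M \<in> \<A>"
  proof (rule mem_retract[OF C M0])
    show "cdg_hom B (transport j M) C (cdg_comp \<psi> (cdg_comp s \<tau>'))"
      by (rule cdg_hom_comp[OF cdg_hom_comp[OF \<tau>' s] \<psi>])
    show "cdg_hom B C (transport j M) (cdg_comp \<tau> (cdg_comp q (cdg_comp p \<phi>)))"
      by (rule cdg_hom_comp[OF cdg_hom_comp[OF cdg_hom_comp[OF \<phi> p] q] \<tau>])
    fix n m assume m: "m \<in> elts (transport j M) n"
    note mem = cdg_hom_mem[OF \<tau>' m] cdg_hom_mem[OF s cdg_hom_mem[OF \<tau>' m]]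
    show "cdg_comp \<tau> (cdg_comp q (cdg_comp p \<phi>)) n (cdg_comp \<psi> (cdg_comp s \<tau>') n m) = m"
      using mem m by (simp add: cdg_comp_def \<phi>\<psi> qps \<tau>\<tau>')
  qed
  then show ?thesis
    unfolding represented_def using M cdg_isomorphic_sym[OF M M0 transport_isomorphic[OF j]] by blast
qed

lemma shift_mem_iff: "M \<in> CMod B \<Longrightarrow> shift M \<in> \<A> \<longleftrightarrow> M \<in> \<A>"
  using thick[unfolded thick_subcategory_def, THEN conjunct2, THEN conjunct2, THEN conjunct2, THEN conjunct1,
      THEN bspec, of M] by simp

lemma cone_mem:
  fixes M N C :: "('b, 'm) cdg_mod"
  assumes "M \<in> \<A>" "N \<in> \<A>" "cdg_hom B M N f" "C \<in> CMod B" "cdg_isomorphic B C (cone M N f)"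
  shows "C \<in> \<A>"
proof -
  note thick[unfolded thick_subcategory_def, THEN conjunct2, THEN conjunct2, THEN conjunct2, THEN conjunct2, THEN conjunct1]
  from this[THEN bspec, OF assms(1), THEN bspec, OF assms(2), THEN spec, THEN mp, OF assms(3), THEN bspec, OF assms(4),
      THEN mp, OF assms(5)]
  show ?thesis .
qed

lemma represented_module: "represented M \<Longrightarrow> cdg_module B M"
  by (simp add: represented_def)

lemma represented_obtain:
  assumes "represented M"
  shows "\<exists>C \<phi>. C \<in> \<A> \<and> cdg_hom B C M \<phi> \<and> (\<forall>n. bij_betw (\<phi> n) (elts C n) (elts M n))"
  using assms unfolding represented_def cdg_isomorphic_def by (elim conjE bexE exE) (intro exI conjI)

lemma copy_exists:
  fixes M :: "('b, 'n) cdg_mod"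
  assumes M: "cdg_module B M" and emb: "\<exists>j :: 'n \<Rightarrow> 'm. inj j"
  shows "\<exists>(C :: ('b, 'm) cdg_mod). cdg_module B C \<and> cdg_isomorphic B C M \<and> cdg_isomorphic B M C"
proof -
  obtain j :: "'n \<Rightarrow> 'm" where j: "inj j" using emb by (elim exE)
  have "cdg_module B (transport j M)"
    using curved_module.transport_module[OF curved_moduleI[OF curved_algebra_axioms M] j] .
  then show ?thesis
    using transport_isomorphic[OF j, of B M] cdg_isomorphic_sym[OF M] by (intro exI[of _ "transport j M"]) simp
qed

lemma represented_shift_iff:
  fixes M :: "('b, 'n) cdg_mod"
  assumes M: "cdg_module B M" and emb: "\<exists>j :: 'n \<Rightarrow> 'm. inj j"
  shows "represented (shift M) \<longleftrightarrow> represented M"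
proof -
  obtain C :: "('b, 'm) cdg_mod" where C: "cdg_module B C" "cdg_isomorphic B C M" "cdg_isomorphic B M C"
    using copy_exists[OF M emb] by (elim exE conjE)
  note sm = curved_module.shift_module[OF curved_moduleI[OF curved_algebra_axioms]]
  have "represented (shift M) \<longleftrightarrow> represented (shift C)"
    using represented_isomorphic[OF _ sm[OF C(1)] shift_isomorphic[OF curved_algebra_axioms M C(1,3)]]
      represented_isomorphic[OF _ sm[OF M] shift_isomorphic[OF curved_algebra_axioms C(1) M C(2)]] by (rule iffI)
  also have "\<dots> \<longleftrightarrow> represented C"
    unfolding represented_mem_iff by (rule shift_mem_iff) (simp add: CMod_def C)
  also have "\<dots> \<longleftrightarrow> represented M"
    using represented_isomorphic[OF _ M C(2)] represented_isomorphic[OF _ C(1,3)] by (rule iffI)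
  finally show ?thesis .
qed

lemma represented_cone:
  fixes M :: "('b, 'x) cdg_mod" and N :: "('b, 'y) cdg_mod"
  assumes M: "represented M" and N: "represented N" and f: "cdg_hom B M N f"
    and emb: "\<exists>j :: 'y \<times> 'x \<Rightarrow> 'm. inj j"
  shows "represented (cone M N f)"
proof -
  obtain C \<phi> where C: "C \<in> \<A>" "cdg_hom B C M \<phi>" "\<forall>n. bij_betw (\<phi> n) (elts C n) (elts M n)"
    using represented_obtain[OF M] by (elim exE conjE)
  obtain D \<psi> where D: "D \<in> \<A>" "cdg_hom B D N \<psi>" "\<forall>n. bij_betw (\<psi> n) (elts D n) (elts N n)"
    using represented_obtain[OF N] by (elim exE conjE)
  note mods = mem_module[OF C(1)] represented_module[OF M] mem_module[OF D(1)] represented_module[OF N]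
  define \<psi>' where "\<psi>' = (\<lambda>n. inv_into (elts D n) (\<psi> n))"
  have \<psi>': "cdg_hom B N D \<psi>'"
    unfolding \<psi>'_def using module_map.inverse_hom[OF module_mapI[OF curved_algebra_axioms mods(3,4) D(2)]] D(3) by simp
  define g where "g = cdg_comp \<psi>' (cdg_comp f \<phi>)"
  have g: "cdg_hom B C D g" unfolding g_def by (rule cdg_hom_comp[OF cdg_hom_comp[OF C(2) f] \<psi>'])
  have comm: "\<psi> n (g n m) = f n (\<phi> n m)" if "m \<in> elts C n" for n m
    using bij_betw_inv_into_right[OF D(3)[rule_format] cdg_hom_mem[OF f cdg_hom_mem[OF C(2) that]]]
    by (simp add: g_def cdg_comp_def \<psi>'_def)
  have iso: "cdg_isomorphic B (cone C D g) (cone M N f)"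
    unfolding cdg_isomorphic_def
    using cone_map[OF curved_algebra_axioms mods C(2) C(3)[rule_format] D(2) D(3)[rule_format] g f comm] by (intro exI conjI allI)
  have cm: "cdg_module B (cone C D g)" "cdg_module B (cone M N f)"
    using module_map.cone_module[OF module_mapI[OF curved_algebra_axioms mods(1,3) g]]
      module_map.cone_module[OF module_mapI[OF curved_algebra_axioms mods(2,4) f]] .
  obtain K :: "('b, 'm) cdg_mod" where K: "cdg_module B K" "cdg_isomorphic B K (cone M N f)"
    using copy_exists[OF cm(2) emb] by (elim exE conjE)
  have "K \<in> \<A>"
    using cone_mem[OF C(1) D(1) g, of K] K(1)
      cdg_isomorphic_trans[OF K(2) cdg_isomorphic_sym[OF cm iso]] by (simp add: CMod_def)
  then show ?thesis unfolding represented_def using K(2) cm(2) by (intro conjI bexI[of _ K])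
qed

text \<open>
  In a triangulated category this is rotation of the triangle of \<open>f\<close>: the cone of the inclusion of \<open>N\<close>
  into \<open>cone f\<close> is homotopy equivalent to \<open>M[1]\<close>. Already in the category of modules \<open>M[1]\<close> is a retract
  of that cone, and this is all that is used. The component \<open>- f x\<close> of the section cancels the
  term \<open>f x\<close> which the predifferential of \<open>cone f\<close> contributes.
\<close>

lemma represented_cone_domain:
  fixes M :: "('b, 'x) cdg_mod" and N :: "('b, 'y) cdg_mod"
  assumes M: "cdg_module B M" and N: "represented N" and f: "cdg_hom B M N f"
    and cone: "represented (cone M N f)"
    and emb: "\<exists>j :: 'x \<Rightarrow> 'm. inj j" "\<exists>j :: 'y \<Rightarrow> 'm. inj j"
  shows "represented M"
proof -
  interpret f: module_map \<eta> B M N f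
    by (rule module_mapI[OF curved_algebra_axioms M represented_module[OF N] f])
  let ?i = "\<lambda>n y. (y, \<one>\<^bsub>comp M (n + 1)\<^esub>)"
  let ?s = "\<lambda>n x. ((\<one>\<^bsub>comp N n\<^esub>, x), inv\<^bsub>comp N (n + 1)\<^esub> (f (n + 1) x))"
  let ?p = "\<lambda>n ((y, x), y'). x"
  have X: "represented (cone N (cone M N f) ?i)"
    by (rule represented_cone[OF N cone f.cone_inclusion]) (intro embeds_prod emb)
  have "represented (shift M)"
  proof (rule represented_retract[OF X f.M.shift_module f.M.shift_module emb(1)])
    show "cdg_hom B (shift M) (cone N (cone M N f) ?i) ?s"
      by (rule cdg_homI)
        (auto simp: f.hom_mult f.hom_act f.hom_mdif f.hom_inv f.hom_ksign f.N.comp.inv_mult f.N.act_inv f.N.mdif_inv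
          f.N.comp.ksign_inv add.assoc[symmetric])
    show "cdg_hom B (cone N (cone M N f) ?i) (shift M) ?p"
      by (rule cdg_homI) (auto simp: add.assoc[symmetric])
  qed (simp add: bij_betw_def)
  then show ?thesis using represented_shift_iff[OF M emb(1)] by simp
qed

text \<open>
  The companion rotation: \<open>N[1]\<close> is a retract of the cone of the projection \<open>cone f \<rightarrow> M[1]\<close>. The
  retraction \<open>(x', y, x) \<mapsto> y + f x'\<close> needs the correction \<open>f x'\<close> to commute with the predifferentials.
\<close>

lemma represented_cone_codomain:
  fixes M :: "('b, 'x) cdg_mod" and N :: "('b, 'y) cdg_mod"
  assumes M: "represented M" and N: "cdg_module B N" and f: "cdg_hom B M N f"
    and cone: "represented (cone M N f)"
    and emb: "\<exists>j :: 'x \<Rightarrow> 'm. inj j" "\<exists>j :: 'y \<Rightarrow> 'm. inj j"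
  shows "represented N"
proof -
  interpret f: module_map \<eta> B M N f
    by (rule module_mapI[OF curved_algebra_axioms represented_module[OF M] N f])
  let ?\<pi> = "\<lambda>n :: int. \<lambda>(y :: 'y, x :: 'x). x"
  let ?s = "\<lambda>n y. (\<one>\<^bsub>comp M (n + 1)\<^esub>, (y, \<one>\<^bsub>comp M (2 + n)\<^esub>))"
  let ?p = "\<lambda>n (x', (y, x)). y \<otimes>\<^bsub>comp N (n + 1)\<^esub> f (n + 1) x'"
  have "represented (shift M)" using represented_shift_iff[OF f.M.cdg_module emb(1)] M by simp
  then have X: "represented (cone (cone M N f) (shift M) ?\<pi>)"
    by (rule represented_cone[OF cone _ f.cone_projection]) (intro embeds_prod emb)
  have "represented (shift N)"
  proof (rule represented_retract[OF X f.N.shift_module f.N.shift_module emb(2)])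
    show "cdg_hom B (shift N) (cone (cone M N f) (shift M) ?\<pi>) ?s"
      by (rule cdg_homI) (auto simp: f.M.comp.comm_group_axioms f.N.comp.comm_group_axioms
          f.M.comp.is_group f.N.comp.is_group f.M.comp.ksign_inv add.assoc[symmetric])
    show "cdg_hom B (cone (cone M N f) (shift M) ?\<pi>) (shift N) ?p"
      by (rule cdg_homI)
        (auto simp: f.hom_mult f.hom_act f.hom_mdif f.hom_inv f.hom_ksign f.N.comp.inv_mult f.N.act_inv f.N.mdif_inv
          f.N.comp.ksign_inv f.N.comp.ksign_mult f.N.act_mult f.N.mdif_mult f.N.comp.m_ac
          f.M.comp.comm_group_axioms f.N.comp.comm_group_axioms f.M.comp.is_group f.N.comp.is_group
          add.assoc[symmetric])
  qed (auto simp add: bij_betw_def inj_on_def)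
  then show ?thesis using represented_shift_iff[OF N emb(2)] by simp
qed

section \<open>Totalizations and extensions\<close>

text \<open>
  Condition (A1) speaks of modules over the fixed type only. Transporting all three modules of the
  sequence there gives an isomorphic totalization, because cones are functorial.
\<close>

lemma represented_totalization:
  fixes M' :: "('b, 'x) cdg_mod" and M :: "('b, 'y) cdg_mod" and M'' :: "('b, 'z) cdg_mod"
  assumes A1: "cond_A1 B \<A>" and M': "cdg_module B M'" and M: "cdg_module B M" and M'': "cdg_module B M''"
    and se: "short_exact B M' M M'' f g"
    and emb: "\<exists>j :: 'x \<Rightarrow> 'm. inj j" "\<exists>j :: 'y \<Rightarrow> 'm. inj j" "\<exists>j :: 'z \<Rightarrow> 'm. inj j"
  shows "represented (totalization M' M M'' f g)"
proof -
  obtain a :: "'x \<Rightarrow> 'm" where a: "inj a" using emb(1) by (elim exE)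
  obtain b :: "'y \<Rightarrow> 'm" where b: "inj b" using emb(2) by (elim exE)
  obtain c :: "'z \<Rightarrow> 'm" where c: "inj c" using emb(3) by (elim exE)
  note tm = curved_module.transport_module[OF curved_moduleI[OF curved_algebra_axioms]]
  let ?M' = "transport a M'" and ?M = "transport b M" and ?M'' = "transport c M''"
  define f0 where "f0 = (\<lambda>n x. b (f n (inv_into UNIV a x)))"
  define g0 where "g0 = (\<lambda>n y. c (g n (inv_into UNIV b y)))"
  have f: "cdg_hom B M' M f" and g: "cdg_hom B M M'' g"
    and fg: "\<And>n. inj_on (f n) (elts M' n)" "\<And>n. f n ` elts M' n = kernel (comp M n) (comp M'' n) (g n)"
      "\<And>n. g n ` elts M n = elts M'' n"
    using se by (auto simp: short_exact_def)
  interpret f: module_map \<eta> B M' M f by (rule module_mapI[OF curved_algebra_axioms M' M f])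
  interpret g: module_map \<eta> B M M'' g by (rule module_mapI[OF curved_algebra_axioms M M'' g])
  have gf: "g n (f n x) = \<one>\<^bsub>comp M'' n\<^esub>" if "x \<in> elts M' n" for n x
    using fg(2)[of n] that by (auto simp: kernel_def)
  have f0: "cdg_hom B ?M' ?M f0"
    by (rule cdg_homI) (auto simp: f0_def a b f.hom_mult f.hom_act f.hom_mdif)
  have g0: "cdg_hom B ?M ?M'' g0"
    by (rule cdg_homI) (auto simp: g0_def b c g.hom_mult g.hom_act g.hom_mdif)
  have "short_exact B ?M' ?M ?M'' f0 g0"
    unfolding short_exact_def
  proof (intro conjI allI f0 g0)
    fix n
    show "inj_on (f0 n) (elts ?M' n)"
      using fg(1)[of n] a b by (auto simp: f0_def inj_eq intro!: inj_onI dest: inj_onD)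
    have "f0 n ` elts ?M' n = b ` (f n ` elts M' n)"
      using a by (auto simp: f0_def image_image)
    also have "\<dots> = kernel (comp ?M n) (comp ?M'' n) (g0 n)"
      unfolding fg(2) using b c by (auto simp: g0_def kernel_def inj_eq)
    finally show "f0 n ` elts ?M' n = kernel (comp ?M n) (comp ?M'' n) (g0 n)" .
    have "g0 n ` elts ?M n = c ` (g n ` elts M n)"
      using b by (auto simp: g0_def image_image)
    then show "g0 n ` elts ?M n = elts ?M'' n" using c fg(3) by simp
  qed
  (* (A1) applies to the transported sequence; it remains to compare the two totalizations. *)
  note A1' = A1[unfolded cond_A1_def CMod_def, simplified, rule_format, OF tm[OF M' a] tm[OF M b] tm[OF M'' c] this]
  have homs: "cdg_hom B (cone M' M f) M'' (\<lambda>n (y, x). g n y)"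
    by (rule cdg_homI) (auto simp: g.hom_mult g.hom_act g.hom_mdif gf)
  interpret f0: module_map \<eta> B ?M' ?M f0 by (rule module_mapI[OF curved_algebra_axioms tm[OF M' a] tm[OF M b] f0])
  interpret g0: module_map \<eta> B ?M ?M'' g0 by (rule module_mapI[OF curved_algebra_axioms tm[OF M b] tm[OF M'' c] g0])
  have gf0: "g0 n (f0 n x) = \<one>\<^bsub>comp ?M'' n\<^esub>" if "x \<in> elts ?M' n" for n x
    using that a b c by (auto simp: g0_def f0_def gf)
  have homs0: "cdg_hom B (cone ?M' ?M f0) ?M'' (\<lambda>n (y, x). g0 n y)"
    by (rule cdg_homI) (auto simp: g0.hom_mult g0.hom_act g0.hom_mdif gf0 simp del: transport_sel)
  have bij: "bij_betw j (elts N n) (elts (transport j N) n)" if "inj j" for j N n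
    using that by (auto simp: bij_betw_def intro: inj_on_subset)
  have hj: "cdg_hom B N (transport j N) (\<lambda>n. j)" if "inj j" for j N
    by (rule cdg_homI) (use that in auto)
  let ?T = "totalization M' M M'' f g"
  note mods = M' tm[OF M' a] M tm[OF M b]
  (* A totalization is a cone of a cone, so functoriality of the cone is used twice. *)
  note cone1 = cone_map[OF curved_algebra_axioms mods hj[OF a] bij[OF a] hj[OF b] bij[OF b] f f0]
  have comm1: "b (f n m) = f0 n (a m)" for n m by (simp add: f0_def a)
  note cone2 = cone_map[OF curved_algebra_axioms f.cone_module f0.cone_module M'' tm[OF M'' c]
      cone1[OF comm1] hj[OF c] bij[OF c] homs homs0]
  have comm2: "c (case m of (y, x) \<Rightarrow> g n y) =
      (case (case m of (y, x) \<Rightarrow> (b y, a x)) of (y, x) \<Rightarrow> g0 n y)" for n m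
    by (cases m) (simp add: g0_def b)
  have iso: "cdg_isomorphic B ?T (totalization ?M' ?M ?M'' f0 g0)"
    unfolding totalization_def cdg_isomorphic_def using cone2[OF comm2] by (intro exI conjI allI)
  have T: "cdg_module B ?T"
    unfolding totalization_def
    by (rule module_map.cone_module[OF module_mapI[OF curved_algebra_axioms f.cone_module M'' homs]])
  obtain K :: "('b, 'm) cdg_mod" where K: "cdg_module B K" "cdg_isomorphic B K ?T"
    using copy_exists[OF T embeds_prod[OF emb(3) embeds_prod[OF emb(2,1)]]] by (elim exE conjE)
  have "K \<in> \<A>"
    by (rule A1'[OF K(1) cdg_isomorphic_trans[OF K(2) iso]])
  then show ?thesis unfolding represented_def using K(2) T by (intro conjI bexI[of _ K])
qed

text \<open>
  The totalization is built from the three modules by two cones, hence two rotations recover the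
  middle term from the totalization and the outer terms.
\<close>

lemma mem_extension:
  assumes A1: "cond_A1 B \<A>" and M': "M' \<in> \<A>" and M: "cdg_module B M" and M'': "M'' \<in> \<A>"
    and se: "short_exact B M' M M'' f g"
  shows "M \<in> \<A>"
proof -
  have f: "cdg_hom B M' M f" and g: "cdg_hom B M M'' g"
    using se by (simp_all add: short_exact_def)
  interpret f: module_map \<eta> B M' M f by (rule module_mapI[OF curved_algebra_axioms mem_module[OF M'] M f])
  interpret g: module_map \<eta> B M M'' g by (rule module_mapI[OF curved_algebra_axioms M mem_module[OF M''] g])
  have gf: "g n (f n x) = \<one>\<^bsub>comp M'' n\<^esub>" if "x \<in> elts M' n" for n x
    using se that unfolding short_exact_def kernel_def by blast
  have h: "cdg_hom B (cone M' M f) M'' (\<lambda>n (y, x). g n y)"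
    by (rule cdg_homI) (auto simp: g.hom_mult g.hom_act g.hom_mdif gf)
  have "represented (totalization M' M M'' f g)"
    by (rule represented_totalization[OF A1 _ M _ se]) (simp_all add: mem_module M' M'' embeds_self)
  from represented_cone_domain[OF f.cone_module _ h this[unfolded totalization_def]
      embeds_prod[OF embeds_self embeds_self] embeds_self]
  have "represented (cone M' M f)" by (simp add: represented_mem_iff M'')
  from represented_cone_codomain[OF _ M f this embeds_self embeds_self]
  have "represented M" by (simp add: represented_mem_iff M')
  then show ?thesis by (simp add: represented_mem_iff)
qed

end

section \<open>Non-split extensions\<close>

text \<open>
  Every extension of \<open>P\<close> by \<open>S\<close> which splits as a sequence of graded groups has this form: \<open>\<alpha>\<close> and
  \<open>\<beta>\<close> are the components from \<open>P\<close> to \<open>S\<close> of the action and of the predifferential. Cones are the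
  case \<open>\<alpha> = 0\<close>; through \<open>\<alpha>\<close> an extension can fail to split over the algebra.
\<close>

definition twisted_extension ::
  "('b, 'm) cdg_mod \<Rightarrow> ('b, 'n) cdg_mod \<Rightarrow> (int \<Rightarrow> int \<Rightarrow> 'b \<Rightarrow> 'n \<Rightarrow> 'm) \<Rightarrow> (int \<Rightarrow> 'n \<Rightarrow> 'm) \<Rightarrow>
   ('b, 'm \<times> 'n) cdg_mod" where
  "twisted_extension S P \<alpha> \<beta> =
     \<lparr>comp = (\<lambda>n. comp S n \<times>\<times> comp P n),
      act = (\<lambda>i n b (s, p). (act S i n b s \<otimes>\<^bsub>comp S (i + n)\<^esub> \<alpha> i n b p, act P i n b p)),
      mdif = (\<lambda>n (s, p). (mdif S n s \<otimes>\<^bsub>comp S (n + 1)\<^esub> \<beta> n p, mdif P n p))\<rparr>"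

lemma twisted_extension_sel [simp]:
  "comp (twisted_extension S P \<alpha> \<beta>) n = comp S n \<times>\<times> comp P n"
  "act (twisted_extension S P \<alpha> \<beta>) i n b (s, p) =
    (act S i n b s \<otimes>\<^bsub>comp S (i + n)\<^esub> \<alpha> i n b p, act P i n b p)"
  "mdif (twisted_extension S P \<alpha> \<beta>) n (s, p) = (mdif S n s \<otimes>\<^bsub>comp S (n + 1)\<^esub> \<beta> n p, mdif P n p)"
  by (simp_all add: twisted_extension_def)

text \<open>
  The conditions on \<open>\<alpha>\<close> and \<open>\<beta>\<close> are the components from \<open>P\<close> to \<open>S\<close> of the module axioms for the
  extension.
\<close>

locale extension_cocycle = S: curved_module \<eta> B S + P: curved_module \<eta> B P
  for \<eta> :: "'r::comm_ring_1 \<Rightarrow> 'b::ring_1" and B and S :: "('b, 'm) cdg_mod" and P :: "('b, 'n) cdg_mod" +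
  fixes \<alpha> :: "int \<Rightarrow> int \<Rightarrow> 'b \<Rightarrow> 'n \<Rightarrow> 'm" and \<beta> :: "int \<Rightarrow> 'n \<Rightarrow> 'm"
  assumes \<alpha>_closed [simp]: "b \<in> deg B i \<Longrightarrow> p \<in> elts P n \<Longrightarrow> k = i + n \<Longrightarrow> \<alpha> i n b p \<in> elts S k"
    and \<alpha>_mult: "b \<in> deg B i \<Longrightarrow> p \<in> elts P n \<Longrightarrow> p' \<in> elts P n \<Longrightarrow>
      \<alpha> i n b (p \<otimes>\<^bsub>comp P n\<^esub> p') = \<alpha> i n b p \<otimes>\<^bsub>comp S (i + n)\<^esub> \<alpha> i n b p'"
    and \<alpha>_add: "b \<in> deg B i \<Longrightarrow> b' \<in> deg B i \<Longrightarrow> p \<in> elts P n \<Longrightarrow>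
      \<alpha> i n (b + b') p = \<alpha> i n b p \<otimes>\<^bsub>comp S (i + n)\<^esub> \<alpha> i n b' p"
    and \<alpha>_unit: "p \<in> elts P n \<Longrightarrow> \<alpha> 0 n 1 p = \<one>\<^bsub>comp S n\<^esub>"
    and \<alpha>_act: "b \<in> deg B i \<Longrightarrow> b' \<in> deg B j \<Longrightarrow> p \<in> elts P n \<Longrightarrow>
      \<alpha> (i + j) n (b * b') p =
        act S i (j + n) b (\<alpha> j n b' p) \<otimes>\<^bsub>comp S (i + j + n)\<^esub> \<alpha> i (j + n) b (act P j n b' p)"
    and \<beta>_closed [simp]: "p \<in> elts P n \<Longrightarrow> k = n + 1 \<Longrightarrow> \<beta> n p \<in> elts S k"
    and \<beta>_mult: "p \<in> elts P n \<Longrightarrow> p' \<in> elts P n \<Longrightarrow>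
      \<beta> n (p \<otimes>\<^bsub>comp P n\<^esub> p') = \<beta> n p \<otimes>\<^bsub>comp S (n + 1)\<^esub> \<beta> n p'"
    and leibniz: "b \<in> deg B i \<Longrightarrow> p \<in> elts P n \<Longrightarrow>
      mdif S (i + n) (\<alpha> i n b p) \<otimes>\<^bsub>comp S (i + n + 1)\<^esub> \<beta> (i + n) (act P i n b p) =
        \<alpha> (i + 1) n (predif B b) p \<otimes>\<^bsub>comp S (i + n + 1)\<^esub>
        ksign (comp S (i + n + 1)) i
          (act S i (n + 1) b (\<beta> n p) \<otimes>\<^bsub>comp S (i + n + 1)\<^esub> \<alpha> i (n + 1) b (mdif P n p))"
    and curvature: "p \<in> elts P n \<Longrightarrow>
      mdif S (n + 1) (\<beta> n p) \<otimes>\<^bsub>comp S (n + 2)\<^esub> \<beta> (n + 1) (mdif P n p) = \<alpha> 2 n (curv B) p"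
begin

abbreviation "E \<equiv> twisted_extension S P \<alpha> \<beta>"

lemma \<alpha>_one [simp]: "b \<in> deg B i \<Longrightarrow> \<alpha> i n b \<one>\<^bsub>comp P n\<^esub> = \<one>\<^bsub>comp S (i + n)\<^esub>"
  by (rule hom_maps_one[OF _ P.comp.comm_group_axioms S.comp.comm_group_axioms]) (auto simp: hom_def \<alpha>_mult)

lemma \<beta>_one [simp]: "\<beta> n \<one>\<^bsub>comp P n\<^esub> = \<one>\<^bsub>comp S (n + 1)\<^esub>"
  by (rule hom_maps_one[OF _ P.comp.comm_group_axioms S.comp.comm_group_axioms]) (auto simp: hom_def \<beta>_mult)

lemma extension_module: "cdg_module B E"
proof (rule cdg_moduleI)
  fix n show "comm_group (comp E n)"
    by (simp add: DirProd_comm_group S.comp.comm_group_axioms P.comp.comm_group_axioms)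
next
  fix i n b m assume b: "b \<in> deg B i" and "m \<in> elts E n"
  then obtain s p where m: "m = (s, p)" "s \<in> elts S n" "p \<in> elts P n" by auto
  have index: "i + 1 + n = i + n + 1" by simp
  have "mdif S (i + n) (act S i n b s) \<otimes>\<^bsub>comp S (i + n + 1)\<^esub>
      (mdif S (i + n) (\<alpha> i n b p) \<otimes>\<^bsub>comp S (i + n + 1)\<^esub> \<beta> (i + n) (act P i n b p)) =
      act S (i + 1) n (predif B b) s \<otimes>\<^bsub>comp S (i + n + 1)\<^esub> \<alpha> (i + 1) n (predif B b) p \<otimes>\<^bsub>comp S (i + n + 1)\<^esub>
      ksign (comp S (i + n + 1)) i (act S i (n + 1) b (mdif S n s \<otimes>\<^bsub>comp S (n + 1)\<^esub> \<beta> n p) \<otimes>\<^bsub>comp S (i + n + 1)\<^esub>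
        \<alpha> i (n + 1) b (mdif P n p))"
    unfolding leibniz[OF b m(3)]
    using b m by (simp add: S.leibniz S.act_mult S.comp.ksign_mult S.comp.m_ac add.assoc[symmetric])
  then show "mdif E (i + n) (act E i n b m) = act E (i + 1) n (predif B b) m \<otimes>\<^bsub>comp E (i + n + 1)\<^esub>
      ksign (comp E (i + n + 1)) i (act E i (n + 1) b (mdif E n m))"
    using b m by (simp add: S.mdif_mult P.leibniz S.comp.m_assoc S.comp.comm_group_axioms P.comp.comm_group_axioms
        index add.assoc[symmetric])
next
  fix n m assume "m \<in> elts E n"
  then obtain s p where m: "m = (s, p)" "s \<in> elts S n" "p \<in> elts P n" by auto
  then show "mdif E (n + 1) (mdif E n m) = act E 2 n (curv B) m"
    using curvature[OF m(3)]
    by (simp add: S.mdif_mult S.mdif_mdif P.mdif_mdif S.comp.m_assoc add.commute[of n 2])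
qed (auto simp: S.act_mult P.act_mult S.act_add P.act_add S.act_act P.act_act S.mdif_mult P.mdif_mult \<alpha>_mult \<alpha>_add \<alpha>_unit
     \<alpha>_act \<beta>_mult S.comp.m_ac add.assoc[symmetric])

lemma extension_short_exact: "short_exact B S E P (\<lambda>n s. (s, \<one>\<^bsub>comp P n\<^esub>)) (\<lambda>n (s, p). p)"
  unfolding short_exact_def
proof (intro conjI allI)
  show "cdg_hom B S E (\<lambda>n s. (s, \<one>\<^bsub>comp P n\<^esub>))"
    by (rule cdg_homI) simp_all
  show "cdg_hom B E P (\<lambda>n (s, p). p)"
    by (rule cdg_homI) auto
qed (auto simp: inj_on_def kernel_def image_iff)

end

section \<open>First order deformations\<close>

locale deformation =
  fixes \<eta> :: "'r::comm_ring_1 \<Rightarrow> 'a::comm_ring_1" and A :: "'a cdg" and u :: 'a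
  assumes alg: "cdg_algebra \<eta> A" and u_deg: "u \<in> deg A 2" and u_closed: "predif A u = 0" and dga: "curv A = 0"
begin

sublocale A: curved_algebra \<eta> A by (rule curved_algebra.intro[OF alg])

abbreviation "\<eta>\<epsilon> \<equiv> \<lambda>r. Dual (\<eta> (std_part r)) (\<eta> (eps_part r))"
abbreviation "A\<epsilon> \<equiv> first_order_deformation A u"
abbreviation "U \<equiv> Dual u 0"
abbreviation "\<epsilon> \<equiv> Dual 0 1"

sublocale curved_algebra "\<eta>\<epsilon>" "A\<epsilon>"
  by (rule curved_algebra.intro) (rule first_order_deformation_cdg_algebra[OF alg u_deg u_closed dga])

lemma predif_0 [simp]: "predif A 0 = 0"
  using A.predif_add[of 0 0] by simp

lemma predif_1 [simp]: "predif A 1 = 0"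
proof -
  have "\<forall>b'. predif A (1 * b') =
      predif A 1 * b' + (if even (0::int) then 1 * predif A b' else - (1 * predif A b'))"
    using alg A.deg_one unfolding cdg_algebra_def by blast
  then have "predif A (1 * 1) = predif A 1 * 1 + 1 * predif A 1" by (simp del: mult_1 mult_1_right)
  then show ?thesis by simp
qed

lemma deg_iff: "b \<in> deg A\<epsilon> i \<longleftrightarrow> std_part b \<in> deg A i \<and> eps_part b \<in> deg A i"
  and predif_eq: "predif A\<epsilon> b = Dual (predif A (std_part b)) (predif A (eps_part b))"
  and curv_eq: "curv A\<epsilon> = Dual 0 u"
  by (simp_all add: first_order_deformation_def)

lemma U_deg [simp]: "U \<in> deg A\<epsilon> 2" and \<epsilon>_deg [simp]: "\<epsilon> \<in> deg A\<epsilon> 0"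
  by (simp_all add: deg_iff u_deg)

lemma predif_U [simp]: "predif A\<epsilon> U = 0" and predif_\<epsilon> [simp]: "predif A\<epsilon> \<epsilon> = 0"
  using predif_eq by (simp_all add: predif_eq u_closed zero_dual_def)

lemma eps_deg [simp]: "b \<in> deg A\<epsilon> i \<Longrightarrow> Dual (eps_part b) 0 \<in> deg A\<epsilon> i"
  by (simp add: deg_iff)

end

section \<open>Modules killed by \<open>\<epsilon>\<close>\<close>

text \<open>
  Restrictions of dg \<open>A\<close>-modules along \<open>\<epsilon> \<mapsto> 0\<close> are of this kind, but so are kernel and image of
  \<open>\<epsilon>\<close> on an arbitrary module over the deformation.
\<close>

locale special_fibre_mod = deformation \<eta> A u + N: curved_module "\<eta>\<epsilon>" "A\<epsilon>" N
  for \<eta> :: "'r::comm_ring_1 \<Rightarrow> 'a::comm_ring_1" and A u and N :: "('a dual, 'm) cdg_mod" +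
  assumes \<epsilon>_zero: "m \<in> elts N n \<Longrightarrow> act N 0 n (Dual 0 1) m = \<one>\<^bsub>comp N n\<^esub>"
begin

lemma act_std:
  assumes b: "b \<in> deg A\<epsilon> i" and m: "m \<in> elts N n"
  shows "act N i n b m = act N i n (Dual (std_part b) 0) m"
proof -
  have d: "Dual (std_part b) 0 \<in> deg A\<epsilon> i" "Dual (eps_part b) 0 * \<epsilon> \<in> deg A\<epsilon> i"
    using b by (simp_all add: deg_iff times_dual_def)
  have "b = Dual (std_part b) 0 + Dual (eps_part b) 0 * \<epsilon>"
    by (simp add: plus_dual_def times_dual_def)
  then have "act N i n b m = act N i n (Dual (std_part b) 0) m \<otimes>\<^bsub>comp N (i + n)\<^esub> act N i n (Dual (eps_part b) 0 * \<epsilon>) m"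
    using N.act_add[OF d m] by simp
  also have "act N i n (Dual (eps_part b) 0 * \<epsilon>) m = act N i n (Dual (eps_part b) 0) (act N 0 n \<epsilon> m)"
    using N.act_act[of "Dual (eps_part b) 0" i \<epsilon> 0 m n n] b m by simp
  finally show ?thesis using \<epsilon>_zero[OF m] b m d by simp
qed

lemma act_eq: "b \<in> deg A\<epsilon> i \<Longrightarrow> b' \<in> deg A\<epsilon> i \<Longrightarrow> std_part b = std_part b' \<Longrightarrow> m \<in> elts N n \<Longrightarrow>
    act N i n b m = act N i n b' m"
  using act_std by metis

text \<open>
  The \<open>\<epsilon>\<close>-part of a product obeys the Leibniz rule, so \<open>b \<mapsto>\<close> (action of the \<open>\<epsilon>\<close>-part of \<open>b\<close>)
  is a derivation along the action. This is the cocycle condition for \<open>\<alpha>\<close> below.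
\<close>

lemma act_eps_mult:
  assumes b: "b \<in> deg A\<epsilon> i" "b' \<in> deg A\<epsilon> j" and m: "m \<in> elts N n"
  shows "act N (i + j) n (Dual (eps_part (b * b')) 0) m =
    act N (i + j) n (b * Dual (eps_part b') 0) m \<otimes>\<^bsub>comp N (i + j + n)\<^esub>
    act N (i + j) n (Dual (eps_part b) 0 * b') m"
proof -
  have d: "b * Dual (eps_part b') 0 \<in> deg A\<epsilon> (i + j)" "Dual (eps_part b) 0 * b' \<in> deg A\<epsilon> (i + j)"
      "Dual (eps_part (b * b')) 0 \<in> deg A\<epsilon> (i + j)"
    using deg_mult[OF b(1) eps_deg[OF b(2)] refl] deg_mult[OF eps_deg[OF b(1)] b(2) refl]
      eps_deg[OF deg_mult[OF b refl]] by simp_all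
  show ?thesis
    unfolding N.act_add[OF d(1,2) m, symmetric]
    by (rule act_eq[OF d(3) deg_add[OF d(1,2)] _ m]) (simp add: times_dual_def plus_dual_def)
qed

sublocale S: curved_module "\<eta>\<epsilon>" "A\<epsilon>" "shift N"
  by (rule curved_moduleI[OF curved_algebra_axioms N.shift_module])

sublocale id: module_map "\<eta>\<epsilon>" "A\<epsilon>" N N cdg_id
  by (rule module_mapI[OF curved_algebra_axioms N.cdg_module N.cdg_module cdg_hom_id])

abbreviation "P \<equiv> cone N N cdg_id"

sublocale P: curved_module "\<eta>\<epsilon>" "A\<epsilon>" P
  by (rule curved_moduleI[OF curved_algebra_axioms id.cone_module])

text \<open>
  These data define the module \<open>E\<close> of the introduction, an extension of the cone of the identity of \<open>N\<close>
  by \<open>N[1]\<close>. The cone has elements \<open>(y, x)\<close> and predifferential \<open>(d y + x, - d x)\<close>. The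
  composite \<open>\<beta> d + d \<beta>\<close> sends \<open>(y, x)\<close> to \<open>u (d y + x) - d (u y) = u x\<close>, which is the action of the
  curvature \<open>u \<epsilon>\<close> through \<open>\<alpha>\<close>.
\<close>

abbreviation "\<alpha> \<equiv> \<lambda>i n b (y, x). act (shift N) i n (Dual (eps_part b) 0) x"
abbreviation "\<beta> \<equiv> \<lambda>n (y, x). act N 2 n U y"

lemma cocycle: "extension_cocycle \<eta>\<epsilon> A\<epsilon> (shift N) P \<alpha> \<beta>"
proof (unfold_locales, goal_cases)
  case (1 b i p n k) then show ?case by auto
next
  case (2 b i p n p') then show ?case by (auto simp: N.act_mult N.comp.ksign_mult add.assoc[symmetric])
next
  case (3 b i b' p n)
  then show ?case
    using S.act_add[OF eps_deg[OF 3(1)] eps_deg[OF 3(2)]] by (auto simp: plus_dual_def simp del: shift_sel)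
next
  case (4 p n) then show ?case by (auto simp: one_dual_def zero_dual_def[symmetric])
next
  case (5 b i b' j p n)
  then obtain y x where p: "p = (y, x)" "x \<in> elts N (n + 1)" by auto
  note b = 5(1,2)
  have d: "b * Dual (eps_part b') 0 \<in> deg A\<epsilon> (i + j)" "Dual (eps_part b) 0 * b' \<in> deg A\<epsilon> (i + j)"
    using deg_mult[OF b(1) eps_deg[OF b(2)] refl] deg_mult[OF eps_deg[OF b(1)] b(2) refl] by simp_all
  show ?case
    using b d p act_eps_mult[OF b p(2)]
    by (simp add: N.act_act N.act_ksign N.comp.ksign_mult add.assoc[symmetric])
next
  case (6 p n k) then show ?case by auto
next
  case (7 p n p') then show ?case by (auto simp: N.act_mult add.assoc[symmetric])
next
  case (8 b i p n)
  then obtain y x where p: "p = (y, x)" "y \<in> elts N n" "x \<in> elts N (n + 1)" by auto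
  note b = 8(1) eps_deg[OF 8(1)]
  have db: "predif A\<epsilon> (Dual (eps_part b) 0) = Dual (eps_part (predif A\<epsilon> b)) 0"
    by (simp add: predif_eq)
  have d: "U * b \<in> deg A\<epsilon> (2 + i)" using deg_mult[OF U_deg b(1) refl] by simp
  show ?case
    using S.leibniz[OF b(2), of x n] b p d eps_deg[OF predif_deg[OF b(1) refl]] unfolding db
    by (simp add: N.act_act N.comp.ksign_mult N.comp.m_ac mult.commute[of b] add.commute[of i 2] add.assoc[symmetric])
next
  case (9 p n) then show ?case by (auto simp: curv_eq N.act_mult N.mdif_inv N.leibniz cdg_id_def N.comp.m_ac add.assoc[symmetric])
qed

sublocale extension_cocycle "\<eta>\<epsilon>" "A\<epsilon>" "shift N" P \<alpha> \<beta>
  by (rule cocycle)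

abbreviation "\<iota> \<equiv> \<lambda>n s. (s, \<one>\<^bsub>comp P n\<^esub>)"
abbreviation "\<pi> \<equiv> \<lambda>n (s, p). p"

text \<open>
  Elements of degree \<open>n\<close> of the totalization are triples \<open>(c, (e, a))\<close> with \<open>c\<close> in degree \<open>n\<close> of
  the cone \<open>P\<close>, \<open>e = (z, (y, x))\<close> in degree \<open>n + 1\<close> of \<open>E\<close>, and \<open>a\<close> in degree \<open>n + 2\<close>
  of \<open>S = N[1]\<close>.
\<close>

definition T where "T = totalization (shift N) E P \<iota> \<pi>"

text \<open>
  The null-homotopy of the inclusion \<open>S \<rightarrow> E\<close>, composed with \<open>u\<close> to avoid its inverse and read as a
  map \<open>N[1] \<rightarrow> T\<close>. The element \<open>x\<close> sits in the coordinate \<open>y\<close> of \<open>e\<close>. The image of \<open>e\<close> in \<open>P\<close>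
  and the term \<open>u x\<close> in \<open>d e\<close> obstruct compatibility with the predifferentials; \<open>c = (0, - x)\<close>
  and \<open>a = - u x\<close> cancel them.
\<close>

definition null_section where
  "null_section n x = ((\<one>\<^bsub>comp N n\<^esub>, inv\<^bsub>comp N (n + 1)\<^esub> x),
     ((\<one>\<^bsub>comp N (2 + n)\<^esub>, (x, \<one>\<^bsub>comp N (2 + n)\<^esub>)), inv\<^bsub>comp N (3 + n)\<^esub> (act N 2 (n + 1) U x)))"

sublocale Emod: curved_module "\<eta>\<epsilon>" "A\<epsilon>" E
  by (rule curved_moduleI[OF curved_algebra_axioms extension_module])

sublocale incl: module_map "\<eta>\<epsilon>" "A\<epsilon>" "shift N" E \<iota>
  by (rule module_mapI[OF curved_algebra_axioms S.cdg_module Emod.cdg_module])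
    (use extension_short_exact in \<open>simp add: short_exact_def\<close>)

sublocale incone: curved_module "\<eta>\<epsilon>" "A\<epsilon>" "cone (shift N) E \<iota>"
  by (rule curved_moduleI[OF curved_algebra_axioms incl.cone_module])

lemma proj_hom: "cdg_hom A\<epsilon> (cone (shift N) E \<iota>) P (\<lambda>n (y, x). \<pi> n y)"
  by (rule cdg_homI) (auto simp: cdg_id_def add.assoc[symmetric])

sublocale tot: module_map "\<eta>\<epsilon>" "A\<epsilon>" "cone (shift N) E \<iota>" P "\<lambda>n (y, x). \<pi> n y"
  by (rule module_mapI[OF curved_algebra_axioms incone.cdg_module P.cdg_module proj_hom])

lemma retraction_hom: "cdg_hom A\<epsilon> T (shift (shift (shift N))) (\<lambda>n t. snd (snd t))"
  unfolding T_def totalization_def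
  using cdg_hom_comp[OF tot.cone_projection
      module_map.shift_hom[OF module_mapI[OF curved_algebra_axioms incone.cdg_module S.shift_module incl.cone_projection]]]
  by (simp add: cdg_comp_def o_def case_prod_beta del: shift_sel)

lemma null_section_hom: "cdg_hom A\<epsilon> (shift N) T null_section"
proof -
  note groups = DirProd_comm_group N.comp.comm_group_axioms DirProd_group N.comp.is_group
  show ?thesis
    unfolding T_def totalization_def
  proof (rule cdg_homI, goal_cases)
    case (1 n m)
    then show ?case by (simp add: null_section_def)
  next
    case (2 n m m')
    then show ?case by (simp add: null_section_def N.act_mult N.comp.inv_mult add.assoc[symmetric])
  next
    case (3 i n b m)
    then have "U * b \<in> deg A\<epsilon> (2 + i)" using deg_mult[OF U_deg 3(1) refl] by simp
    then show ?case using 3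
      by (simp add: null_section_def N.act_act N.act_inv N.act_ksign N.comp.ksign_inv groups mult.commute[of b]
        add.commute[of i 2] add.assoc[symmetric])
  next
    case (4 n m)
    then show ?case
      by (simp add: null_section_def N.act_act N.act_inv N.mdif_inv N.leibniz groups cdg_id_def N.comp.inv_mult add.assoc[symmetric])
  qed
qed

end

text \<open>
  The last coordinate of the totalization is a morphism onto \<open>S[2] = N[3]\<close>, and composed with
  \<^const>\<open>special_fibre_mod.null_section\<close> it is \<open>- u : N[1] \<rightarrow> N[3]\<close>. As \<open>u\<close> is bijective, \<open>N[1]\<close> is a
  retract of the totalization.
\<close>

theorem special_fibre_mem:
  fixes N :: "('a::comm_ring_1 dual, 'm) cdg_mod" and \<eta> :: "'r::comm_ring_1 \<Rightarrow> 'a"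
  assumes N: "special_fibre_mod \<eta> A u N"
    and thick: "thick_subcategory (first_order_deformation A u) \<A>" "infinite (UNIV :: 'm set)"
    and A1: "cond_A1 (first_order_deformation A u) \<A>"
    and bij: "\<And>n. bij_betw (act N 2 n (Dual u 0)) (elts N n) (elts N (2 + n))"
  shows "N \<in> \<A>"
proof -
  interpret special_fibre_mod \<eta> A u N by fact
  interpret thick "\<eta>\<epsilon>" "A\<epsilon>" \<A>
    by unfold_locales fact+
  have T: "represented T"
    unfolding T_def
    by (rule represented_totalization[OF A1 S.cdg_module Emod.cdg_module P.cdg_module extension_short_exact])
      (intro embeds_prod embeds_self)+
  have "represented (shift N)"
  proof (rule represented_retract[OF T S.cdg_module _ embeds_self null_section_hom retraction_hom])
    show "cdg_module A\<epsilon> (shift (shift (shift N)))"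
      by (rule curved_module.shift_module[OF curved_moduleI[OF curved_algebra_axioms S.shift_module]])
    fix n
    have "bij_betw (m_inv (comp N (3 + n))) (elts N (3 + n)) (elts N (3 + n))"
      by (rule bij_betw_byWitness[where f' = "m_inv (comp N (3 + n))"]) auto
    from bij_betw_trans[OF bij[of "n + 1"], of "m_inv (comp N (3 + n))"] this
    show "bij_betw (\<lambda>m. snd (snd (null_section n m))) (elts (shift N) n) (elts (shift (shift (shift N))) n)"
      by (simp add: null_section_def o_def add.assoc[symmetric])
  qed
  then show ?thesis
    using represented_shift_iff[OF N.cdg_module embeds_self] represented_mem_iff by simp
qed

section \<open>A non-acyclic module with invertible \<open>u\<close>\<close>

text \<open>
  Evaluation at \<open>u = 1\<close>.
\<close>

definition coeff_sum :: "('e \<Rightarrow>\<^sub>0 'k::comm_ring_1) \<Rightarrow> 'k" where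
  "coeff_sum f = (\<Sum>e \<in> Poly_Mapping.keys f. Poly_Mapping.lookup f e)"

lemma coeff_sum_superset:
  assumes "finite S" "Poly_Mapping.keys f \<subseteq> S"
  shows "coeff_sum f = (\<Sum>e \<in> S. Poly_Mapping.lookup f e)"
  unfolding coeff_sum_def by (rule sum.mono_neutral_left) (use assms in \<open>auto simp: in_keys_iff\<close>)

lemma coeff_sum_add:
  fixes f g :: "'e \<Rightarrow>\<^sub>0 'k::comm_ring_1"
  shows "coeff_sum (f + g) = coeff_sum f + coeff_sum g"
proof -
  let ?S = "Poly_Mapping.keys f \<union> Poly_Mapping.keys g"
  have "coeff_sum h = (\<Sum>e \<in> ?S. Poly_Mapping.lookup h e)" if "Poly_Mapping.keys h \<subseteq> ?S" for h :: "'e \<Rightarrow>\<^sub>0 'k"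
    by (rule coeff_sum_superset) (use that in simp_all)
  from this[of f] this[of g] this[of "f + g"] show ?thesis
    using keys_add[of f g] by (simp add: lookup_add sum.distrib)
qed

lemma coeff_sum_single [simp]: "coeff_sum (Poly_Mapping.single e c) = c"
  by (simp add: coeff_sum_def lookup_single)

lemma coeff_sum_0 [simp]: "coeff_sum 0 = 0" by (simp add: coeff_sum_def)

lemma coeff_sum_sum: "coeff_sum (sum f S) = (\<Sum>s \<in> S. coeff_sum (f s))"
  by (induction S rule: infinite_finite_induct) (simp_all add: coeff_sum_add)

lemma sum_of_monomials:
  "f = (\<Sum>e \<in> Poly_Mapping.keys f. Poly_Mapping.single e (Poly_Mapping.lookup f e))"
  by (rule poly_mapping_eqI)
    (auto simp: lookup_sum lookup_single when_def in_keys_iff sum.delta)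

lemma coeff_sum_mult:
  fixes f g :: "'e::comm_monoid_add \<Rightarrow>\<^sub>0 'k::comm_ring_1"
  shows "coeff_sum (f * g) = coeff_sum f * coeff_sum g"
proof -
  have "f * g = (\<Sum>e \<in> Poly_Mapping.keys f. Poly_Mapping.single e (Poly_Mapping.lookup f e)) *
      (\<Sum>e \<in> Poly_Mapping.keys g. Poly_Mapping.single e (Poly_Mapping.lookup g e))"
    using sum_of_monomials[of f] sum_of_monomials[of g] by simp
  then have "coeff_sum (f * g) = (\<Sum>e \<in> Poly_Mapping.keys f. \<Sum>e' \<in> Poly_Mapping.keys g.
      Poly_Mapping.lookup f e * Poly_Mapping.lookup g e')"
    by (simp add: sum_product mult_single coeff_sum_sum)
  then show ?thesis by (simp add: coeff_sum_def sum_product)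
qed

lemma coeff_sum_1 [simp]: "coeff_sum (1 :: 'e::comm_monoid_add \<Rightarrow>\<^sub>0 'k::comm_ring_1) = 1"
  using coeff_sum_single[of "0 :: 'e" "1 :: 'k"] by simp

text \<open>
  The sum of \<open>k[u, u\<^sup>-\<^sup>1]\<close> and its shift, with zero differential. Multiplication by powers of \<open>u\<close>
  identifies all homogeneous components of \<open>k[u, u\<^sup>-\<^sup>1]\<close> of even degree with \<open>k\<close>; adding the shift
  puts a copy of \<open>k\<close> into each odd degree as well, so that no parity has to be distinguished.
\<close>

definition coeff_sum_module :: "('e \<Rightarrow>\<^sub>0 'k::comm_ring_1, 'k) cdg_mod" where
  "coeff_sum_module =
     \<lparr>comp = (\<lambda>n. \<lparr>carrier = UNIV, monoid.mult = (+), one = 0\<rparr>),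
      act = (\<lambda>i n f x. coeff_sum f * x), mdif = (\<lambda>n x. 0)\<rparr>"

lemma coeff_sum_module_sel [simp]:
  "comp coeff_sum_module n = \<lparr>carrier = UNIV, monoid.mult = (+), one = 0\<rparr>"
  "act coeff_sum_module i n f x = coeff_sum f * x" "mdif coeff_sum_module n x = 0"
  by (simp_all add: coeff_sum_module_def)

lemma additive_comm_group: "comm_group \<lparr>carrier = UNIV :: 'k::ab_group_add set, monoid.mult = (+), one = 0\<rparr>"
  by (rule comm_groupI) (auto simp: add.assoc add.commute intro: exI[of _ "- _"])

lemma coeff_sum_module:
  "cdg_module (monomial_dga wt) (coeff_sum_module :: ('e::comm_monoid_add \<Rightarrow>\<^sub>0 'k::comm_ring_1, 'k) cdg_mod)"
proof (rule cdg_moduleI)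
  have G: "comm_group \<lparr>carrier = UNIV :: 'k set, monoid.mult = (+), one = 0\<rparr>"
    by (rule additive_comm_group)
  fix i n :: int and b :: "'e \<Rightarrow>\<^sub>0 'k" and m :: 'k
  show "mdif coeff_sum_module (i + n) (act coeff_sum_module i n b m) =
    act coeff_sum_module (i + 1) n (predif (monomial_dga wt) b) m \<otimes>\<^bsub>comp coeff_sum_module (i + n + 1)\<^esub>
    ksign (comp coeff_sum_module (i + n + 1)) i (act coeff_sum_module i (n + 1) b (mdif coeff_sum_module n m))"
    using sign_group.ksign_one[OF sign_group.intro[OF G]] by (simp add: monomial_dga_def)
qed (simp_all add: additive_comm_group coeff_sum_add coeff_sum_mult algebra_simps monomial_dga_def)

lemma restrict_scalars_sel [simp]:
  "comp (restrict_scalars \<rho> M) n = comp M n" "act (restrict_scalars \<rho> M) i n b m = act M i n (\<rho> b) m"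
  "mdif (restrict_scalars \<rho> M) n m = mdif M n m"
  by (simp_all add: restrict_scalars_def)

lemma (in deformation) restricted_special_fibre_mod:
  assumes "cdg_module A M"
  shows "special_fibre_mod \<eta> A u (restrict_scalars std_part M)"
proof -
  interpret M: curved_module \<eta> A M by (rule curved_moduleI[OF A.curved_algebra_axioms assms])
  have "cdg_module A\<epsilon> (restrict_scalars std_part M)"
    using restrict_scalars_CMod[of A M u] assms dga by (simp add: CMod_def)
  then interpret R: curved_module "\<eta>\<epsilon>" "A\<epsilon>" "restrict_scalars std_part M"
    by (rule curved_moduleI[OF curved_algebra_axioms])
  show ?thesis
    by unfold_locales simp
qed

text \<open>
  Deforming the derived category of \<open>A\<close> would force the module above, which belongs to \<open>\<A>\<close>, to be
  acyclic; but its differential is zero and the module is not.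
\<close>

lemma not_deforms:
  fixes wt :: "'e::{comm_monoid_add, one} \<Rightarrow> int"
    and \<A> :: "(('e \<Rightarrow>\<^sub>0 'k::comm_ring_1) dual, 'm) cdg_mod set"
  assumes wt: "\<And>a b. wt (a + b) = wt a + wt b" "wt 1 = 2"
    and universe: "infinite (UNIV :: 'm set)" "inj (j :: 'k \<Rightarrow> 'm)"
    and thick: "thick_subcategory (first_order_deformation (monomial_dga wt) u_var) \<A>"
    and A1: "cond_A1 (first_order_deformation (monomial_dga wt) u_var) \<A>"
  shows "\<not> deforms (monomial_dga wt) std_part \<A>"
proof
  assume deforms: "deforms (monomial_dga wt) std_part \<A>"
  interpret deformation "Poly_Mapping.single 0 :: 'k \<Rightarrow> 'e \<Rightarrow>\<^sub>0 'k" "monomial_dga wt" u_var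
    by unfold_locales (use monomial_dga_cdg_algebra[of wt] wt in \<open>auto simp: monomial_dga_def u_var_def\<close>)
  let ?K = "coeff_sum_module :: ('e \<Rightarrow>\<^sub>0 'k, 'k) cdg_mod"
  let ?M = "transport j ?K"
  have M: "cdg_module (monomial_dga wt) ?M"
    by (rule curved_module.transport_module[OF curved_moduleI[OF A.curved_algebra_axioms coeff_sum_module] universe(2)])
  have "restrict_scalars std_part ?M \<in> \<A>"
  proof (rule special_fibre_mem[OF restricted_special_fibre_mod[OF M] thick universe(1) A1])
    fix n
    show "bij_betw (act (restrict_scalars std_part ?M) 2 n (Dual u_var 0))
        (elts (restrict_scalars std_part ?M) n) (elts (restrict_scalars std_part ?M) (2 + n))"
      by (rule bij_betw_byWitness[where f' = id]) (use universe(2) in \<open>auto simp: u_var_def\<close>)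
  qed
  then have "acyclic_module ?M"
    using deforms M by (simp add: deforms_def CMod_def)
  then have "kernel (comp ?M 0) (comp ?M 1) (mdif ?M 0) = mdif ?M (- 1) ` elts ?M (- 1)"
    unfolding acyclic_module_def by (metis add_0 diff_0)
  moreover have "j 1 \<in> kernel (comp ?M 0) (comp ?M 1) (mdif ?M 0)"
    using universe(2) by (simp add: kernel_def)
  ultimately have "j 1 = j 0" using universe(2) by auto
  then show False using universe(2) by (simp add: inj_eq)
qed

section \<open>Modules over an algebra with invertible \<open>u\<close>\<close>

context deformation
begin

text \<open>
  As \<open>\<epsilon>\<close> is central and closed of degree zero, it acts on every module by an endomorphism; its kernel
  and image are modules again.
\<close>

lemma eps_hom:
  assumes "cdg_module A\<epsilon> M"
  shows "cdg_hom A\<epsilon> M M (\<lambda>n. act M 0 n \<epsilon>)"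
proof -
  interpret M: curved_module "\<eta>\<epsilon>" "A\<epsilon>" M by (rule curved_moduleI[OF curved_algebra_axioms assms])
  show ?thesis
  proof (rule cdg_homI, goal_cases)
    case (1 n m) then show ?case by simp
  next
    case (2 n m m') then show ?case by (simp add: M.act_mult)
  next
    case (3 i n b m) then show ?case by (simp add: M.act_act mult.commute)
  next
    case (4 n m) then show ?case using M.leibniz[OF \<epsilon>_deg 4, of n] by (simp add: add.commute[of 1 n])
  qed
qed

lemma unit_curvature_all_mem:
  fixes \<A> :: "('a dual, 'm) cdg_mod set"
  assumes v: "v \<in> deg A (- 2)" "u * v = 1"
    and thick: "thick_subcategory A\<epsilon> \<A>" "infinite (UNIV :: 'm set)" and A1: "cond_A1 A\<epsilon> \<A>"
    and M: "cdg_module A\<epsilon> M"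
  shows "M \<in> \<A>"
proof -
  have special: "N \<in> \<A>" if N: "cdg_module A\<epsilon> N"
    and z: "\<And>n m. m \<in> elts N n \<Longrightarrow> act N 0 n \<epsilon> m = \<one>\<^bsub>comp N n\<^esub>" for N
  proof -
    interpret N: curved_module "\<eta>\<epsilon>" "A\<epsilon>" N by (rule curved_moduleI[OF curved_algebra_axioms N])
    have "special_fibre_mod \<eta> A u N"
      by unfold_locales (rule z)
    then show ?thesis
    proof (rule special_fibre_mem[OF _ thick A1])
      have V: "Dual v 0 \<in> deg A\<epsilon> (- 2)" using v by (simp add: deg_iff)
      have UV: "Dual v 0 * U = 1" "U * Dual v 0 = 1"
        using v(2) by (simp_all add: times_dual_def one_dual_def mult.commute)
      fix n
      show "bij_betw (act N 2 n U) (elts N n) (elts N (2 + n))"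
        by (rule bij_betw_byWitness[where f' = "act N (- 2) (2 + n) (Dual v 0)"])
          (use V UV in \<open>auto simp: N.act_act\<close>)
    qed
  qed
  interpret M: curved_module "\<eta>\<epsilon>" "A\<epsilon>" M by (rule curved_moduleI[OF curved_algebra_axioms M])
  interpret e: module_map "\<eta>\<epsilon>" "A\<epsilon>" M M "\<lambda>n. act M 0 n \<epsilon>"
    by (rule module_mapI[OF curved_algebra_axioms M M eps_hom[OF M]])
  interpret thick "\<eta>\<epsilon>" "A\<epsilon>" \<A> by unfold_locales fact+
  have "\<epsilon> * \<epsilon> = (0 :: 'a dual)" by (simp add: times_dual_def zero_dual_def)
  then show ?thesis
    by (intro mem_extension[OF A1 special[OF e.kernel_module] M special[OF e.image_module] e.kernel_image_short_exact])
      (auto simp: kernel_def M.act_act)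
qed

end

section \<open>The category of all modules and the zero quotient\<close>

context curved_algebra
begin

text \<open>
  Thick subcategories are non-empty, so one module \<open>M0\<close> carried by the type in question has to be
  given.
\<close>

lemma CMod_thick:
  fixes M0 :: "('b, 'm) cdg_mod"
  assumes "cdg_module B M0"
  shows "thick_subcategory B (CMod B :: ('b, 'm) cdg_mod set)"
    "cond_A1 B (CMod B :: ('b, 'm) cdg_mod set)" "cond_A2 B (CMod B :: ('b, 'm) cdg_mod set)"
proof -
  have sh: "shift M \<in> CMod B" if "M \<in> CMod B" for M :: "('b, 'm) cdg_mod"
    using that curved_module.shift_module[OF curved_moduleI[OF curved_algebra_axioms]] by (simp add: CMod_def)
  have "(CMod B :: ('b, 'm) cdg_mod set) \<noteq> {}" using assms by (auto simp: CMod_def)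
  with sh show "thick_subcategory B (CMod B :: ('b, 'm) cdg_mod set)"
    unfolding thick_subcategory_def by (intro conjI ballI allI impI iffI) simp_all
  show "cond_A1 B (CMod B :: ('b, 'm) cdg_mod set)" by (simp add: cond_A1_def)
  show "cond_A2 B (CMod B :: ('b, 'm) cdg_mod set)" by (simp add: cond_A2_def homotopy_coproduct_def)
qed

text \<open>
  If every module is acyclic, then the zero morphism into \<open>M\<close> is a possible left leg of a roof, since
  its cone is \<open>M\<close>. So any two roofs have a common refinement through the zero module, and they are equal.
\<close>

lemma quotient_zeroI:
  fixes \<A> :: "('b, 'm) cdg_mod set"
  assumes all: "\<And>M :: ('b, 'm) cdg_mod. cdg_module B M \<Longrightarrow> M \<in> \<A>"
  shows "quotient_zero B \<A>"
proof -
  have "roof_eq B \<A> M N (X, s, f) (Y, t, g)"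
    if M: "cdg_module B M" and N: "cdg_module B N" and X: "cdg_module B X" and Y: "cdg_module B Y"
      and s: "cdg_hom B X M s" and f: "cdg_hom B X N f" and t: "cdg_hom B Y M t" and g: "cdg_hom B Y N g"
    for M N X Y :: "('b, 'm) cdg_mod" and s f t g
  proof -
    interpret s: module_map \<eta> B X M s by (rule module_mapI[OF curved_algebra_axioms X M s])
    interpret f: module_map \<eta> B X N f by (rule module_mapI[OF curved_algebra_axioms X N f])
    interpret t: module_map \<eta> B Y M t by (rule module_mapI[OF curved_algebra_axioms Y M t])
    interpret g: module_map \<eta> B Y N g by (rule module_mapI[OF curved_algebra_axioms Y N g])
    (* The zero submodule of \<open>M\<close> serves as the zero module. *)
    let ?Z = "submodule M (\<lambda>n. {\<one>\<^bsub>comp M n\<^esub>})"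
    have Z: "cdg_module B ?Z"
      by (rule s.N.submodule_module) (auto simp: s.N.comp.triv_subgroup)
    have a: "cdg_hom B ?Z X (\<lambda>n z. \<one>\<^bsub>comp X n\<^esub>)" by (rule cdg_homI) auto
    have b: "cdg_hom B ?Z Y (\<lambda>n z. \<one>\<^bsub>comp Y n\<^esub>)" by (rule cdg_homI) auto
    have sa: "cdg_hom B ?Z M (cdg_comp s (\<lambda>n z. \<one>\<^bsub>comp X n\<^esub>))" by (rule cdg_hom_comp[OF a s])
    interpret Z: curved_module \<eta> B ?Z by (rule curved_moduleI[OF curved_algebra_axioms Z])
    interpret z: module_map \<eta> B ?Z M "cdg_comp s (\<lambda>n z. \<one>\<^bsub>comp X n\<^esub>)"
      by (rule module_mapI[OF curved_algebra_axioms Z M sa])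
    have "cdg_isomorphic B M (cone ?Z M (cdg_comp s (\<lambda>n z. \<one>\<^bsub>comp X n\<^esub>)))"
      unfolding cdg_isomorphic_def
      by (intro exI[of _ "\<lambda>n y. (y, \<one>\<^bsub>comp ?Z (n + 1)\<^esub>)"] conjI z.cone_inclusion)
        (auto simp: bij_betw_def inj_on_def)
    then have "cone_in B \<A> ?Z M (cdg_comp s (\<lambda>n z. \<one>\<^bsub>comp X n\<^esub>))"
      unfolding cone_in_def using sa all[OF M] by blast
    moreover have "homotopic B ?Z M (cdg_comp s (\<lambda>n z. \<one>\<^bsub>comp X n\<^esub>)) (cdg_comp t (\<lambda>n z. \<one>\<^bsub>comp Y n\<^esub>))"
      by (rule homotopicI[OF Z M]) (simp_all add: cdg_comp_def)
    moreover have "homotopic B ?Z N (cdg_comp f (\<lambda>n z. \<one>\<^bsub>comp X n\<^esub>)) (cdg_comp g (\<lambda>n z. \<one>\<^bsub>comp Y n\<^esub>))"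
      by (rule homotopicI[OF Z N]) (simp_all add: cdg_comp_def)
    ultimately show ?thesis
      unfolding roof_eq_def prod.case using a b Z
      by (intro bexI[of _ ?Z] exI conjI) (assumption | simp only: CMod_def mem_Collect_eq)+
  qed
  then show ?thesis
    unfolding quotient_zero_def roofs_def by (auto simp: CMod_def cone_in_def)
qed

end

theorem proposition3p7:
  assumes "infinite (UNIV :: 'm set)"
    and "\<exists>j :: 'k::comm_ring_1 \<Rightarrow> 'm. inj j"
  shows "(\<nexists>\<A> :: ((nat \<Rightarrow>\<^sub>0 'k) dual, 'm) cdg_mod set.
            thick_subcategory poly_curved \<A> \<and> cond_A1 poly_curved \<A> \<and> deforms poly_dga std_part \<A>) \<and>
         (\<nexists>\<A> :: ((int \<Rightarrow>\<^sub>0 'k) dual, 'm) cdg_mod set.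
            thick_subcategory laurent_curved \<A> \<and> cond_A1 laurent_curved \<A> \<and> deforms laurent_dga std_part \<A>) \<and>
         ((\<forall>x::'k. x \<noteq> 0 \<longrightarrow> (\<exists>y. x * y = 1)) \<longrightarrow>
            (\<exists>\<A> :: ((int \<Rightarrow>\<^sub>0 'k) dual, 'm) cdg_mod set.
               thick_subcategory laurent_curved \<A> \<and> cond_A1 laurent_curved \<A> \<and> cond_A2 laurent_curved \<A>) \<and>
            (\<forall>\<A> :: ((int \<Rightarrow>\<^sub>0 'k) dual, 'm) cdg_mod set.
               thick_subcategory laurent_curved \<A> \<and> cond_A1 laurent_curved \<A> \<and> cond_A2 laurent_curved \<A> \<longrightarrow>
               quotient_zero laurent_curved \<A>))"
proof -
  obtain j :: "'k \<Rightarrow> 'm" where j: "inj j" using assms(2) by (elim exE)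
  have poly: "\<not> deforms poly_dga std_part \<A>"
    if "thick_subcategory poly_curved \<A>" "cond_A1 poly_curved \<A>" for \<A> :: "((nat \<Rightarrow>\<^sub>0 'k) dual, 'm) cdg_mod set"
    using not_deforms[of "\<lambda>e. 2 * int e", OF _ _ assms(1) j that[unfolded poly_dga_def]]
    by (simp add: poly_dga_def)
  have laurent: "\<not> deforms laurent_dga std_part \<A>"
    if "thick_subcategory laurent_curved \<A>" "cond_A1 laurent_curved \<A>" for \<A> :: "((int \<Rightarrow>\<^sub>0 'k) dual, 'm) cdg_mod set"
    using not_deforms[of "\<lambda>e. 2 * e", OF _ _ assms(1) j that[unfolded laurent_dga_def]]
    by (simp add: laurent_dga_def)
  interpret deformation "Poly_Mapping.single 0 :: 'k \<Rightarrow> int \<Rightarrow>\<^sub>0 'k" laurent_dga u_var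
    by unfold_locales
      (use laurent_dga_cdg_algebra in \<open>auto simp: laurent_dga_def monomial_dga_def u_var_def\<close>)
  let ?M = "restrict_scalars std_part (transport j (coeff_sum_module :: (int \<Rightarrow>\<^sub>0 'k, 'k) cdg_mod))"
  have "cdg_module laurent_dga (coeff_sum_module :: (int \<Rightarrow>\<^sub>0 'k, 'k) cdg_mod)"
    unfolding laurent_dga_def by (rule coeff_sum_module)
  from curved_module.transport_module[OF curved_moduleI[OF A.curved_algebra_axioms this] j]
  have M: "cdg_module laurent_curved ?M"
    using restrict_scalars_CMod[of "laurent_dga :: (int \<Rightarrow>\<^sub>0 'k) cdg" _ u_var] dga by (simp add: CMod_def)
  (* Over the Laurent polynomials \<open>u\<close> is a unit, with inverse of degree \<open>-2\<close>. *)
  have inv: "Poly_Mapping.single (- 1) 1 \<in> deg (laurent_dga :: (int \<Rightarrow>\<^sub>0 'k) cdg) (- 2)"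
    "(u_var :: int \<Rightarrow>\<^sub>0 'k) * Poly_Mapping.single (- 1) 1 = 1"
    by (simp_all add: laurent_dga_def monomial_dga_def u_var_def mult_single)
  have "quotient_zero laurent_curved \<A>"
    if "thick_subcategory laurent_curved \<A>" "cond_A1 laurent_curved \<A>" for \<A> :: "((int \<Rightarrow>\<^sub>0 'k) dual, 'm) cdg_mod set"
    by (rule quotient_zeroI) (rule unit_curvature_all_mem[OF inv that(1) assms(1) that(2)])
  then show ?thesis using poly laurent CMod_thick[OF M] by blast
qed

end
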